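(* Let $A$ be a finite abelian group of even order and exponent at least $3$, let $y\in A$ have order $2$, and let $G=\mathrm{Dic}(A,y)=\langle A,x \mid x^2=y,\ xax^{-1}=a^{-1}\ (a\in A)\rangle$. Let $S\subseteq G$ with $1\notin S$, $S^{-1}=S$ and $\langle S\rangle=G$. Then $\mathrm{Cay}(G,S)$ is distance integral if and only if $(A,\ell_S)\in C(A)$ and $|\pi(A,\ell_S(x\cdot))|\in\mathbb{Z}$ for every irreducible (i.e. one-dimensional) representation $\pi:A\to\mathbb{C}^*$ with $A^2\not\subseteq\ker(\pi)$.
   Context: $\ell_S:G\to\mathbb{N}$ is defined by $\ell_S(1)=0$ and, for $g\ne1$, $\ell_S(g)$ is the least $n\ge1$ such that $g=x_1\cdots x_n$ with $x_i\in S$. $\ell_S(x\cdot):A\to\mathbb{N}$ is $a\mapsto\ell_S(xa)$. $(A,\ell_S)$ denotes the multi-set with underlying set $A$ and multiplicity function $\ell_S|_A$. A multi-set is a pair $(T,f)$ with $f:T\to\mathbb{N}$; for $\kappa:T\to\mathbb{C}$, $\kappa(T,f)=\sum_{t\in T}f(t)\kappa(t)$. The sum $(T_1,f_1)+(T_2,f_2)$ is $(T_1\cup T_2,f)$ where $f(t)=\tilde f_1(t)+\tilde f_2(t)$, $\tilde f_i$ extending $f_i$ by $0$. For $g\in A$, the atom $[g]=\{a\in A:\langle a\rangle=\langle g\rangle\}$. $C(A)$ is the set of multi-sets of the form $\sum_{[a]\in T}([a],f_a)$ where $T$ is a set of atoms of $A$ and each $f_a:[a]\to\mathbb{N}$ is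 constant. $A^2=\{a^2:a\in A\}$. The Cayley graph $\mathrm{Cay}(G,S)$ has vertex set $G$ and edges $\{g,h\}$ with $g^{-1}h\in S$; a connected graph is distance integral if all eigenvalues of its distance matrix are integers. *)

theory Defs
  imports Complex_Main "HOL-Algebra.Algebra" "Graph_Theory.Graph_Theory"
begin

section \<open>Generalized dicyclic groups\<close>

text \<open>
  Normal-form model of \<open>\<langle>A, x | x\<^sup>2 = y, x a x\<^sup>-\<^sup>1 = a\<^sup>-\<^sup>1 (a \<in> A)\<rangle>\<close>: the pair \<open>(a, False)\<close>
  stands for \<open>a\<close> and \<open>(a, True)\<close> for \<open>x a\<close>. The product is read off from \<open>a x = x a\<^sup>-\<^sup>1\<close>.
  The lemmas \<open>group_Dic\<close>, \<open>Dic_relations\<close>, \<open>generate_Dic\<close>, \<open>Dic_universal\<close> and \<open>Dic_unique\<close>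
  below show that this is the group defined by the presentation.
\<close>

fun dic_mult :: "('a, 'b) monoid_scheme \<Rightarrow> 'a \<Rightarrow> 'a \<times> bool \<Rightarrow> 'a \<times> bool \<Rightarrow> 'a \<times> bool" where
  "dic_mult A y (a, False) (b, False) = (a \<otimes>\<^bsub>A\<^esub> b, False)"
| "dic_mult A y (a, False) (b, True) = (inv\<^bsub>A\<^esub> a \<otimes>\<^bsub>A\<^esub> b, True)"
| "dic_mult A y (a, True) (b, False) = (a \<otimes>\<^bsub>A\<^esub> b, True)"
| "dic_mult A y (a, True) (b, True) = (y \<otimes>\<^bsub>A\<^esub> (inv\<^bsub>A\<^esub> a \<otimes>\<^bsub>A\<^esub> b), False)"

definition Dic :: "('a, 'b) monoid_scheme \<Rightarrow> 'a \<Rightarrow> ('a \<times> bool) monoid" where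
  "Dic A y = \<lparr>carrier = carrier A \<times> UNIV, monoid.mult = dic_mult A y, one = (\<one>\<^bsub>A\<^esub>, False)\<rparr>"

definition dic_emb :: "'a \<Rightarrow> 'a \<times> bool" where
  "dic_emb a = (a, False)"

definition dic_x :: "('a, 'b) monoid_scheme \<Rightarrow> 'a \<times> bool" where
  "dic_x A = (\<one>\<^bsub>A\<^esub>, True)"

context comm_group
begin

lemma group_Dic:
  assumes y: "y \<in> carrier G" "y \<otimes> y = \<one>"
  shows "group (Dic G y)"
proof (rule groupI)
  have iy: "inv y = y"
    using y by (simp add: inv_equality)
  fix g h k
  assume g: "g \<in> carrier (Dic G y)" and h: "h \<in> carrier (Dic G y)"
  obtain a p where [simp]: "g = (a, p)" by force
  obtain b q where [simp]: "h = (b, q)" by force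
  have [simp]: "a \<in> carrier G" "b \<in> carrier G"
    using g h by (auto simp: Dic_def)
  show "g \<otimes>\<^bsub>Dic G y\<^esub> h \<in> carrier (Dic G y)"
    using y by (cases p; cases q) (auto simp: Dic_def)
  assume k: "k \<in> carrier (Dic G y)"
  obtain c r where [simp]: "k = (c, r)" by force
  have [simp]: "c \<in> carrier G"
    using k by (auto simp: Dic_def)
  show "(g \<otimes>\<^bsub>Dic G y\<^esub> h) \<otimes>\<^bsub>Dic G y\<^esub> k = g \<otimes>\<^bsub>Dic G y\<^esub> (h \<otimes>\<^bsub>Dic G y\<^esub> k)"
    using y iy by (cases p; cases q; cases r) (auto simp: Dic_def inv_mult m_ac)
next
  show "\<one>\<^bsub>Dic G y\<^esub> \<in> carrier (Dic G y)"
    by (simp add: Dic_def)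
next
  fix g assume g: "g \<in> carrier (Dic G y)"
  obtain a p where [simp]: "g = (a, p)" by force
  have [simp]: "a \<in> carrier G"
    using g by (auto simp: Dic_def)
  show "\<one>\<^bsub>Dic G y\<^esub> \<otimes>\<^bsub>Dic G y\<^esub> g = g"
    by (cases p) (auto simp: Dic_def)
  show "\<exists>h\<in>carrier (Dic G y). h \<otimes>\<^bsub>Dic G y\<^esub> g = \<one>\<^bsub>Dic G y\<^esub>"
  proof (cases p)
    case True
    then show ?thesis
      using y by (intro bexI[of _ "(y \<otimes> a, True)"]) (simp_all add: Dic_def inv_mult m_assoc)
  next
    case False
    then show ?thesis
      by (intro bexI[of _ "(inv a, False)"]) (simp_all add: Dic_def)
  qed
qed

lemma dic_emb_hom: "dic_emb \<in> hom G (Dic G y)"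
  by (auto simp: hom_def Dic_def dic_emb_def)

lemma inj_dic_emb: "inj dic_emb"
  by (auto simp: inj_def dic_emb_def)

lemma Dic_normal_form:
  "a \<in> carrier G \<Longrightarrow> dic_x G \<otimes>\<^bsub>Dic G y\<^esub> dic_emb a = (a, True)"
  by (simp add: Dic_def dic_x_def dic_emb_def)

lemma Dic_relations:
  assumes y: "y \<in> carrier G" "y \<otimes> y = \<one>"
  shows "dic_x G \<otimes>\<^bsub>Dic G y\<^esub> dic_x G = dic_emb y"
    and "a \<in> carrier G \<Longrightarrow>
      dic_x G \<otimes>\<^bsub>Dic G y\<^esub> dic_emb a \<otimes>\<^bsub>Dic G y\<^esub> inv\<^bsub>Dic G y\<^esub> dic_x G = dic_emb (inv a)"
proof -
  interpret D: group "Dic G y" using y by (rule group_Dic)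
  show "dic_x G \<otimes>\<^bsub>Dic G y\<^esub> dic_x G = dic_emb y"
    using y by (simp add: Dic_def dic_x_def dic_emb_def)
  assume a: "a \<in> carrier G"
  have c: "dic_x G \<in> carrier (Dic G y)" "dic_emb a \<in> carrier (Dic G y)"
    "dic_emb (inv a) \<in> carrier (Dic G y)"
    using a by (auto simp: Dic_def dic_x_def dic_emb_def)
  have "dic_x G \<otimes>\<^bsub>Dic G y\<^esub> dic_emb a = dic_emb (inv a) \<otimes>\<^bsub>Dic G y\<^esub> dic_x G"
    using a by (simp add: Dic_def dic_x_def dic_emb_def)
  then show "dic_x G \<otimes>\<^bsub>Dic G y\<^esub> dic_emb a \<otimes>\<^bsub>Dic G y\<^esub> inv\<^bsub>Dic G y\<^esub> dic_x G = dic_emb (inv a)"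
    using c by (simp add: D.m_assoc)
qed

lemma generate_Dic:
  assumes y: "y \<in> carrier G" "y \<otimes> y = \<one>"
  shows "generate (Dic G y) (insert (dic_x G) (dic_emb ` carrier G)) = carrier (Dic G y)"
    (is "generate ?D ?X = _")
proof
  interpret D: group "Dic G y" using y by (rule group_Dic)
  have "?X \<subseteq> carrier ?D"
    by (auto simp: Dic_def dic_x_def dic_emb_def)
  then show "generate ?D ?X \<subseteq> carrier ?D"
    by (rule D.generate_incl)
  show "carrier ?D \<subseteq> generate ?D ?X"
  proof
    fix g assume g: "g \<in> carrier ?D"
    obtain a p where gp: "g = (a, p)" by force
    have a: "a \<in> carrier G" using g gp by (auto simp: Dic_def)
    have 1: "dic_emb a \<in> generate ?D ?X"
      using a by (intro generate.incl) auto
    have "dic_x G \<otimes>\<^bsub>?D\<^esub> dic_emb a \<in> generate ?D ?X"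
      by (rule generate.eng[OF generate.incl 1]) auto
    then show "g \<in> generate ?D ?X"
      using 1 a gp by (cases p) (simp_all add: Dic_normal_form, simp add: dic_emb_def)
  qed
qed

lemma Dic_universal:
  assumes y: "y \<in> carrier G" "y \<otimes> y = \<one>"
    and H: "group H" and \<phi>: "\<phi> \<in> hom G H" and h: "h \<in> carrier H"
    and rel1: "h \<otimes>\<^bsub>H\<^esub> h = \<phi> y"
    and rel2: "\<And>a. a \<in> carrier G \<Longrightarrow> h \<otimes>\<^bsub>H\<^esub> \<phi> a \<otimes>\<^bsub>H\<^esub> inv\<^bsub>H\<^esub> h = inv\<^bsub>H\<^esub> \<phi> a"
  shows "\<exists>\<psi>\<in>hom (Dic G y) H. (\<forall>a\<in>carrier G. \<psi> (dic_emb a) = \<phi> a) \<and> \<psi> (dic_x G) = h"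
proof -
  interpret H: group H by (rule H)
  interpret P: group_hom G H \<phi>
    using \<phi> by unfold_locales
  have sw: "\<phi> a \<otimes>\<^bsub>H\<^esub> h = h \<otimes>\<^bsub>H\<^esub> inv\<^bsub>H\<^esub> \<phi> a" if a: "a \<in> carrier G" for a
  proof -
    have "h \<otimes>\<^bsub>H\<^esub> \<phi> (inv a) = (h \<otimes>\<^bsub>H\<^esub> \<phi> (inv a) \<otimes>\<^bsub>H\<^esub> inv\<^bsub>H\<^esub> h) \<otimes>\<^bsub>H\<^esub> h"
      using a h by (simp add: H.m_assoc)
    also have "\<dots> = \<phi> a \<otimes>\<^bsub>H\<^esub> h"
      using a h by (subst rel2) auto
    finally show ?thesis using a by simp
  qed
  define \<psi> where "\<psi> = (\<lambda>(a, p). if p then h \<otimes>\<^bsub>H\<^esub> \<phi> a else \<phi> a)"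
  have sw': "\<phi> a \<otimes>\<^bsub>H\<^esub> (h \<otimes>\<^bsub>H\<^esub> z) = h \<otimes>\<^bsub>H\<^esub> (inv\<^bsub>H\<^esub> \<phi> a \<otimes>\<^bsub>H\<^esub> z)"
    if "a \<in> carrier G" "z \<in> carrier H" for a z
    using that h sw[of a] by (simp flip: H.m_assoc)
  have rel1': "h \<otimes>\<^bsub>H\<^esub> (h \<otimes>\<^bsub>H\<^esub> z) = \<phi> y \<otimes>\<^bsub>H\<^esub> z" if "z \<in> carrier H" for z
    using that h rel1 by (simp flip: H.m_assoc)
  have "\<psi> \<in> hom (Dic G y) H"
  proof (rule homI)
    fix g assume "g \<in> carrier (Dic G y)"
    then show "\<psi> g \<in> carrier H"
      using h by (auto simp: \<psi>_def Dic_def)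
  next
    fix g k assume g: "g \<in> carrier (Dic G y)" and k: "k \<in> carrier (Dic G y)"
    obtain a p where [simp]: "g = (a, p)" by force
    obtain b q where [simp]: "k = (b, q)" by force
    have [simp]: "a \<in> carrier G" "b \<in> carrier G"
      using g k by (auto simp: Dic_def)
    show "\<psi> (g \<otimes>\<^bsub>Dic G y\<^esub> k) = \<psi> g \<otimes>\<^bsub>H\<^esub> \<psi> k"
      using y h by (cases p; cases q) (auto simp: \<psi>_def Dic_def H.m_assoc sw' rel1')
  qed
  moreover have "\<psi> (dic_emb a) = \<phi> a" for a
    by (simp add: \<psi>_def dic_emb_def)
  moreover have "\<psi> (dic_x G) = h"
    using h by (simp add: \<psi>_def dic_x_def)
  ultimately show ?thesis by blast
qed

lemma Dic_unique:
  assumes \<psi>: "\<psi> \<in> hom (Dic G y) H" and \<psi>': "\<psi>' \<in> hom (Dic G y) H"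
    and eq: "\<And>a. a \<in> carrier G \<Longrightarrow> \<psi> (dic_emb a) = \<psi>' (dic_emb a)" "\<psi> (dic_x G) = \<psi>' (dic_x G)"
    and g: "g \<in> carrier (Dic G y)"
  shows "\<psi> g = \<psi>' g"
proof -
  obtain a p where gp: "g = (a, p)" by force
  have a: "a \<in> carrier G" using g gp by (auto simp: Dic_def)
  have c: "dic_x G \<in> carrier (Dic G y)" "dic_emb a \<in> carrier (Dic G y)"
    using a by (auto simp: Dic_def dic_x_def dic_emb_def)
  show ?thesis
  proof (cases p)
    case True
    then have "g = dic_x G \<otimes>\<^bsub>Dic G y\<^esub> dic_emb a"
      using a gp by (simp add: Dic_normal_form)
    then show ?thesis
      using c eq a hom_mult[OF \<psi> c] hom_mult[OF \<psi>' c] by simp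
  next
    case False
    then show ?thesis using eq(1)[OF a] gp by (simp add: dic_emb_def)
  qed
qed

end


section \<open>Group-theoretic notions\<close>

definition group_exponent :: "('a, 'b) monoid_scheme \<Rightarrow> nat" where
  "group_exponent G = (LEAST n. 0 < n \<and> (\<forall>a\<in>carrier G. a [^]\<^bsub>G\<^esub> n = \<one>\<^bsub>G\<^esub>))"

definition word_length :: "('a, 'b) monoid_scheme \<Rightarrow> 'a set \<Rightarrow> 'a \<Rightarrow> nat" where
  "word_length G S g =
    (if g = \<one>\<^bsub>G\<^esub> then 0
     else (LEAST n. 1 \<le> n \<and>
       (\<exists>xs. length xs = n \<and> set xs \<subseteq> S \<and> g = foldr (\<otimes>\<^bsub>G\<^esub>) xs \<one>\<^bsub>G\<^esub>)))"

definition complex_units :: "complex monoid" where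
  "complex_units = \<lparr>carrier = UNIV - {0}, monoid.mult = (*), one = 1\<rparr>"

definition group_squares :: "('a, 'b) monoid_scheme \<Rightarrow> 'a set" where
  "group_squares A = {a \<otimes>\<^bsub>A\<^esub> a |a. a \<in> carrier A}"

definition atom :: "('a, 'b) monoid_scheme \<Rightarrow> 'a \<Rightarrow> 'a set" where
  "atom A g = {a \<in> carrier A. generate A {a} = generate A {g}}"

definition atoms :: "('a, 'b) monoid_scheme \<Rightarrow> 'a set set" where
  "atoms A = atom A ` carrier A"


section \<open>Multi-sets with an explicit underlying set\<close>

text \<open>
  The library's \<open>multiset\<close> type forgets elements of multiplicity \<open>0\<close>, whereas here the
  underlying set is part of the data. A pair \<open>(T, f)\<close> with \<open>f : T \<rightarrow> \<nat>\<close> is represented with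
  \<open>f\<close> extensional (\<open>undefined\<close> outside \<open>T\<close>), so that equality of pairs is the intended one.
\<close>

type_synonym 'a mset_pair = "'a set \<times> ('a \<Rightarrow> nat)"

definition mk_mset :: "'a set \<Rightarrow> ('a \<Rightarrow> nat) \<Rightarrow> 'a mset_pair" where
  "mk_mset T f = (T, restrict f T)"

definition mset_mult :: "'a mset_pair \<Rightarrow> 'a \<Rightarrow> nat" where
  "mset_mult M t = (if t \<in> fst M then snd M t else 0)"

definition mset_plus :: "'a mset_pair \<Rightarrow> 'a mset_pair \<Rightarrow> 'a mset_pair" where
  "mset_plus M N = mk_mset (fst M \<union> fst N) (\<lambda>t. mset_mult M t + mset_mult N t)"

definition mset_sum :: "('i \<Rightarrow> 'a mset_pair) \<Rightarrow> 'i set \<Rightarrow> 'a mset_pair" where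
  "mset_sum M I = mk_mset (\<Union>i\<in>I. fst (M i)) (\<lambda>t. \<Sum>i\<in>I. mset_mult (M i) t)"

lemma mset_sum_insert:
  assumes "finite I" "i \<notin> I"
  shows "mset_sum M (insert i I) = mset_plus (M i) (mset_sum M I)"
  using assms
  by (auto simp: mset_sum_def mset_plus_def mk_mset_def mset_mult_def restrict_def fun_eq_iff
      intro!: sum.neutral)

lemma mset_sum_singleton: "mset_sum (\<lambda>i. mk_mset (T i) (f i)) {i} = mk_mset (T i) (f i)"
  by (auto simp: mset_sum_def mk_mset_def mset_mult_def)

definition mset_eval :: "('a \<Rightarrow> complex) \<Rightarrow> 'a mset_pair \<Rightarrow> complex" where
  "mset_eval \<kappa> M = (\<Sum>t\<in>fst M. of_nat (snd M t) * \<kappa> t)"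

definition atomic_msets :: "('a, 'b) monoid_scheme \<Rightarrow> 'a mset_pair set" where
  "atomic_msets A =
    {mset_sum (\<lambda>\<alpha>. mk_mset \<alpha> (f \<alpha>)) T |T f.
       T \<subseteq> atoms A \<and> (\<forall>\<alpha>\<in>T. \<exists>c. \<forall>a\<in>\<alpha>. f \<alpha> a = c)}"


section \<open>Cayley graphs and distance integrality\<close>

text \<open>
  An undirected graph is represented as a symmetric digraph, as in the
  graph theory library; \<open>cayley_graph G S\<close> is symmetric and loop-free when \<open>S = S\<^sup>-\<^sup>1\<close> and \<open>1 \<notin> S\<close>.
\<close>

definition cayley_graph :: "('a, 'b) monoid_scheme \<Rightarrow> 'a set \<Rightarrow> 'a pair_pre_digraph" where
  "cayley_graph G S =
    \<lparr>pverts = carrier G,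
     parcs = {(g, h). g \<in> carrier G \<and> h \<in> carrier G \<and> inv\<^bsub>G\<^esub> g \<otimes>\<^bsub>G\<^esub> h \<in> S}\<rparr>"

definition graph_dist :: "('v, 'e) pre_digraph \<Rightarrow> 'v \<Rightarrow> 'v \<Rightarrow> nat" where
  "graph_dist \<Gamma> u v = (LEAST n. \<exists>p. pre_digraph.awalk \<Gamma> u p v \<and> length p = n)"

text \<open>Eigenvalues of a square matrix whose rows and columns are indexed by the finite set \<open>V\<close>.\<close>

definition is_eigenvalue :: "'v set \<Rightarrow> ('v \<Rightarrow> 'v \<Rightarrow> complex) \<Rightarrow> complex \<Rightarrow> bool" where
  "is_eigenvalue V M \<mu> \<longleftrightarrow>
    (\<exists>f. (\<exists>v\<in>V. f v \<noteq> 0) \<and> (\<forall>u\<in>V. (\<Sum>v\<in>V. M u v * f v) = \<mu> * f u))"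

definition distance_matrix :: "('v, 'e) pre_digraph \<Rightarrow> 'v \<Rightarrow> 'v \<Rightarrow> complex" where
  "distance_matrix \<Gamma> u v = of_nat (graph_dist \<Gamma> u v)"

definition distance_integral :: "('v, 'e) pre_digraph \<Rightarrow> bool" where
  "distance_integral \<Gamma> \<longleftrightarrow>
    Digraph_Component.connected \<Gamma> \<and>
    (\<forall>\<mu>. is_eigenvalue (verts \<Gamma>) (distance_matrix \<Gamma>) \<mu> \<longrightarrow> \<mu> \<in> \<int>)"

end

theory Submission
  imports "Jordan_Normal_Form.Char_Poly" "HOL-Number_Theory.Cong" Defs
begin

text \<open>
  Write \<open>L a = \<ell>(a)\<close> and \<open>M a = \<ell>(x a)\<close>, and let \<open>\<pi>\<close> range over the characters of \<open>A\<close>. The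
  distance matrix preserves the span of \<open>(\<pi>, 0)\<close> and \<open>(0, \<pi>\<^sup>-\<^sup>1)\<close>, and its eigenvalues there are
  \<open>\<pi>(L) \<plusminus> \<bar>\<pi>(M)\<bar>\<close>; as the characters are complete, these are all eigenvalues. They are integers for
  both signs if and only if \<open>\<pi>(L)\<close> and \<open>\<bar>\<pi>(M)\<bar>\<close> are, because \<open>\<pi>(L)\<close> is an algebraic integer. If
  \<open>\<pi>\<close> is trivial on squares, its values are \<open>1\<close> and \<open>-1\<close>, so that \<open>\<pi>(M)\<close> is an integer anyway.

  If \<open>L\<close> is constant on atoms, every \<open>\<pi>(L)\<close> is an integer: an atom is a cyclic subgroup minus
  smaller atoms, and \<open>\<pi>\<close> sums to \<open>0\<close> or to the order over a subgroup. Conversely, suppose that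
  every \<open>\<pi>(L)\<close> is an integer. For a prime \<open>p\<close> the Frobenius congruence gives \<open>\<pi>\<^sup>p(L) \<equiv> \<pi>(L)\<close>
  modulo \<open>p\<close>, and for large \<open>p\<close> this is an equality because both sides are bounded. Two generators
  \<open>a\<close>, \<open>b\<close> of the same cyclic group satisfy \<open>b = a\<^sup>k\<close> where all prime factors of \<open>k\<close> may be taken
  large; hence \<open>\<pi>\<^sup>k(L) = \<pi>(L)\<close> for all \<open>\<pi>\<close>, and completeness yields \<open>L a = L b\<close>. This replaces
  the Galois action on roots of unity, and with it the irreducibility of the cyclotomic polynomials.
\<close>

hide_const (open) Divisibility.prime


section \<open>Algebraic integers\<close>

lemma is_eigenvalue_imp_eigenvalue_mat:
  assumes e: "bij_betw e {..<n} I" and "is_eigenvalue I M \<mu>"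
  shows "eigenvalue (mat n n (\<lambda>(j, k). M (e j) (e k))) \<mu>" (is "eigenvalue ?M \<mu>")
proof -
  obtain f i where i: "i \<in> I" "f i \<noteq> 0"
    and f: "\<And>u. u \<in> I \<Longrightarrow> (\<Sum>v\<in>I. M u v * f v) = \<mu> * f u"
    using assms(2) unfolding is_eigenvalue_def by blast
  define w where "w = vec n (f \<circ> e)"
  obtain j where "j < n" "e j = i" using e i(1) by (auto simp: bij_betw_def)
  then have "w $ j \<noteq> 0" using i(2) by (simp add: w_def)
  then have "w \<noteq> 0\<^sub>v n" using \<open>j < n\<close> by auto
  moreover have "?M *\<^sub>v w = \<mu> \<cdot>\<^sub>v w"
  proof (rule eq_vecI)
    fix k assume "k < dim_vec (\<mu> \<cdot>\<^sub>v w)"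
    then have k: "k < n" by (simp add: w_def)
    then have "(?M *\<^sub>v w) $ k = (\<Sum>l<n. M (e k) (e l) * f (e l))"
      by (simp add: w_def scalar_prod_def atLeast0LessThan)
    also have "\<dots> = (\<Sum>v\<in>I. M (e k) v * f v)"
      by (rule sum.reindex_bij_betw[OF e])
    also have "\<dots> = \<mu> * f (e k)"
      using e k by (intro f) (auto simp: bij_betw_def)
    finally show "(?M *\<^sub>v w) $ k = (\<mu> \<cdot>\<^sub>v w) $ k" using k by (simp add: w_def)
  qed (simp add: w_def)
  ultimately show ?thesis
    unfolding eigenvalue_def eigenvector_def by (intro exI[of _ w]) (simp add: w_def)
qed

lemma is_eigenvalue_of_int_imp_algebraic_int:
  assumes "finite I" and "is_eigenvalue I (\<lambda>j k. of_int (c j k)) z"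
  shows "algebraic_int z"
proof -
  define n where "n = card I"
  obtain e where e: "bij_betw e {..<n} I"
    using ex_bij_betw_nat_finite[OF assms(1)] by (auto simp: n_def atLeast0LessThan)
  define C where "C = mat n n (\<lambda>(j, k). c (e j) (e k))"
  have C: "C \<in> carrier_mat n n" by (simp add: C_def)
  have "map_mat of_int C = mat n n (\<lambda>(j, k). of_int (c (e j) (e k)) :: complex)"
    by (rule eq_matI) (simp_all add: C_def)
  then have "eigenvalue (map_mat of_int C) z"
    using is_eigenvalue_imp_eigenvalue_mat[OF e assms(2)] by simp
  then have "poly (map_poly of_int (char_poly C)) z = 0"
    using eigenvalue_root_char_poly[of "map_mat of_int C" n z] C
    by (simp only: of_int_hom.char_poly_hom[OF C]) simp
  moreover have "Polynomial.lead_coeff (char_poly C) = 1"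
    using degree_monic_char_poly[OF C] by simp
  ultimately show ?thesis
    unfolding algebraic_int_altdef_ipoly by blast
qed

interpretation int_module: Modules.module "\<lambda>n (z::complex). of_int n * z"
  by unfold_locales (simp_all add: algebra_simps)

lemma mult_int_span_closed:
  assumes "\<And>b. b \<in> B \<Longrightarrow> z * b \<in> int_module.span B" and "w \<in> int_module.span B"
  shows "z * w \<in> int_module.span B"
  using assms(2)
proof (induction rule: int_module.span_induct_alt)
  case base
  show ?case by (simp add: int_module.span_zero)
next
  case (step n b w)
  have "z * (of_int n * b + w) = of_int n * (z * b) + z * w" by (simp add: algebra_simps)
  then show ?case
    using step assms(1) by (simp add: int_module.span_add int_module.span_scale)
qed

lemma algebraic_int_if_int_span_stable:
  assumes B: "finite B" "b \<in> B" "b \<noteq> 0"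
    and stable: "\<And>b. b \<in> B \<Longrightarrow> z * b \<in> int_module.span B"
  shows "algebraic_int z"
proof -
  have "\<forall>u\<in>B. \<exists>c. z * u = (\<Sum>v\<in>B. of_int (c v) * v)"
    using stable unfolding int_module.span_finite[OF B(1)] by blast
  then obtain c where "\<And>u. u \<in> B \<Longrightarrow> z * u = (\<Sum>v\<in>B. of_int (c u v) * v)" by metis
  then have "is_eigenvalue B (\<lambda>u v. of_int (c u v)) z"
    unfolding is_eigenvalue_def using B(2,3) by (intro exI[of _ "\<lambda>v. v"]) auto
  with B(1) show ?thesis by (rule is_eigenvalue_of_int_imp_algebraic_int)
qed

lemma algebraic_int_power_reduction:
  fixes z :: complex
  assumes "algebraic_int z"
  obtains n and c :: "nat \<Rightarrow> int" where "z ^ n = (\<Sum>k<n. of_int (c k) * z ^ k)" "n > 0"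
proof -
  obtain p where p: "poly (map_poly of_int p) z = 0" "Polynomial.lead_coeff p = 1"
    using assms unfolding algebraic_int_altdef_ipoly by blast
  define n where "n = Polynomial.degree p"
  have "0 = (\<Sum>k\<le>n. of_int (poly.coeff p k) * z ^ k)"
    using p(1) by (simp add: poly_altdef n_def)
  also have "\<dots> = (\<Sum>k<n. of_int (poly.coeff p k) * z ^ k) + z ^ n"
    using p(2) by (simp add: lessThan_Suc_atMost[symmetric] n_def)
  finally have "z ^ n = (\<Sum>k<n. of_int (- poly.coeff p k) * z ^ k)"
    by (simp add: sum_negf add_eq_0_iff2)
  moreover from this have "n > 0" by (cases n) auto
  ultimately show thesis by (rule that)
qed

lemma power_reduction_imp_mult_mem_int_span:
  assumes z: "z ^ n = (\<Sum>k<n. of_int (c k) * z ^ k)"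
    and mem: "\<And>k. k < n \<Longrightarrow> z ^ k * w \<in> int_module.span B" and "i < n"
  shows "z * (z ^ i * w) \<in> int_module.span B"
proof (cases "Suc i = n")
  case True
  have "(\<Sum>k<n. of_int (c k) * (z ^ k * w)) \<in> int_module.span B"
    by (intro int_module.span_sum int_module.span_scale mem) simp
  moreover have "z * (z ^ i * w) = z ^ n * w" by (simp add: mult.assoc flip: True)
  ultimately show ?thesis unfolding z by (simp add: sum_distrib_right mult.assoc)
next
  case False
  then show ?thesis using mem[of "Suc i"] \<open>i < n\<close> by (simp add: mult.assoc)
qed

lemma exists_int_span_stable:
  assumes "algebraic_int x" "algebraic_int y"
  obtains B where "finite B" "1 \<in> B"
    "\<forall>b\<in>B. x * b \<in> int_module.span B" "\<forall>b\<in>B. y * b \<in> int_module.span B"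
proof -
  obtain m c where x: "x ^ m = (\<Sum>k<m. of_int (c k) * x ^ k)" "m > 0"
    using assms(1) by (rule algebraic_int_power_reduction)
  obtain n d where y: "y ^ n = (\<Sum>k<n. of_int (d k) * y ^ k)" "n > 0"
    using assms(2) by (rule algebraic_int_power_reduction)
  define B where "B = {x ^ i * y ^ j |i j. i < m \<and> j < n}"
  have monom: "x ^ i * y ^ j \<in> int_module.span B" if "i < m" "j < n" for i j
    using that by (intro int_module.span_base) (auto simp: B_def)
  show thesis
  proof (rule that)
    have "B = (\<lambda>(i, j). x ^ i * y ^ j) ` ({..<m} \<times> {..<n})" by (auto simp: B_def)
    then show "finite B" by simp
    show "1 \<in> B" using x(2) y(2) by (force simp: B_def)
    have "x * (x ^ i * y ^ j) \<in> int_module.span B" if "i < m" "j < n" for i j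
      using that by (intro power_reduction_imp_mult_mem_int_span[OF x(1)] monom)
    then show "\<forall>b\<in>B. x * b \<in> int_module.span B" by (auto simp: B_def)
    have "y * (y ^ j * x ^ i) \<in> int_module.span B" if "i < m" "j < n" for i j
      using that monom
      by (intro power_reduction_imp_mult_mem_int_span[OF y(1)]) (simp_all add: mult.commute)
    then show "\<forall>b\<in>B. y * b \<in> int_module.span B" by (auto simp: B_def mult.commute[of "x ^ _"])
  qed
qed

lemma algebraic_int_add:
  fixes x y :: complex
  assumes "algebraic_int x" "algebraic_int y"
  shows "algebraic_int (x + y)"
proof -
  obtain B where B: "finite B" "1 \<in> B"
    "\<forall>b\<in>B. x * b \<in> int_module.span B" "\<forall>b\<in>B. y * b \<in> int_module.span B"
    using exists_int_span_stable[OF assms] by blast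
  have "(x + y) * b \<in> int_module.span B" if "b \<in> B" for b
    using B(3,4) that by (simp add: distrib_right int_module.span_add)
  then show ?thesis by (rule algebraic_int_if_int_span_stable[OF B(1,2) one_neq_zero])
qed

lemma algebraic_int_mult:
  fixes x y :: complex
  assumes "algebraic_int x" "algebraic_int y"
  shows "algebraic_int (x * y)"
proof -
  obtain B where B: "finite B" "1 \<in> B"
    "\<forall>b\<in>B. x * b \<in> int_module.span B" "\<forall>b\<in>B. y * b \<in> int_module.span B"
    using exists_int_span_stable[OF assms] by blast
  have "(x * y) * b \<in> int_module.span B" if "b \<in> B" for b
    using B(3,4) that by (simp add: mult.assoc mult_int_span_closed)
  then show ?thesis by (rule algebraic_int_if_int_span_stable[OF B(1,2) one_neq_zero])
qed

lemma algebraic_int_sum: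
  fixes f :: "'i \<Rightarrow> complex"
  assumes "\<And>i. i \<in> I \<Longrightarrow> algebraic_int (f i)"
  shows "algebraic_int (sum f I)"
  using assms by (induction I rule: infinite_finite_induct) (auto intro: algebraic_int_add)

lemma algebraic_int_power:
  fixes x :: complex
  shows "algebraic_int x \<Longrightarrow> algebraic_int (x ^ n)"
  by (induction n) (simp_all add: algebraic_int_mult int_imp_algebraic_int)

lemma algebraic_int_root_of_unity:
  fixes z :: complex
  assumes "z ^ n = 1" "n > 0"
  shows "algebraic_int z"
  by (rule algebraic_int_root[of 1 "Polynomial.monom 1 n"])
    (use assms in \<open>simp_all add: poly_monom Polynomial.degree_monom_eq int_imp_algebraic_int\<close>)


section \<open>Congruence of algebraic integers\<close>

text \<open>For \<open>m = 0\<close> the quotient is \<open>0\<close>, so any two numbers are congruent modulo \<open>0\<close>.\<close>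

definition algebraic_int_cong :: "nat \<Rightarrow> complex \<Rightarrow> complex \<Rightarrow> bool" where
  "algebraic_int_cong m x y \<longleftrightarrow> algebraic_int ((x - y) / of_nat m)"

lemma algebraic_int_cong_refl: "algebraic_int_cong m x x"
  by (simp add: algebraic_int_cong_def)

lemma algebraic_int_cong_sym: "algebraic_int_cong m x y \<Longrightarrow> algebraic_int_cong m y x"
  unfolding algebraic_int_cong_def
  by (metis algebraic_int_minus minus_diff_eq minus_divide_left)

lemma algebraic_int_cong_trans [trans]:
  assumes "algebraic_int_cong m x y" "algebraic_int_cong m y z"
  shows "algebraic_int_cong m x z"
  using algebraic_int_add[of "(x - y) / of_nat m" "(y - z) / of_nat m"] assms
  by (simp add: algebraic_int_cong_def flip: add_divide_distrib)

lemma algebraic_int_cong_add: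
  assumes "algebraic_int_cong m x x'" "algebraic_int_cong m y y'"
  shows "algebraic_int_cong m (x + y) (x' + y')"
  using algebraic_int_add[of "(x - x') / of_nat m" "(y - y') / of_nat m"] assms
  by (simp add: algebraic_int_cong_def add_diff_add add_divide_distrib)

lemma algebraic_int_cong_mult_right:
  assumes "algebraic_int_cong m x y" "algebraic_int z"
  shows "algebraic_int_cong m (x * z) (y * z)"
  using algebraic_int_mult[of "(x - y) / of_nat m" z] assms
  by (simp add: algebraic_int_cong_def left_diff_distrib)

lemma algebraic_int_cong_sum:
  assumes "\<And>i. i \<in> I \<Longrightarrow> algebraic_int_cong m (f i) (g i)"
  shows "algebraic_int_cong m (sum f I) (sum g I)"
  using assms
  by (induction I rule: infinite_finite_induct)
    (auto intro: algebraic_int_cong_refl algebraic_int_cong_add)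

lemma algebraic_int_cong_frobenius_add:
  assumes p: "prime p" and x: "algebraic_int x" and y: "algebraic_int y"
  shows "algebraic_int_cong p ((x + y) ^ p) (x ^ p + y ^ p)"
proof -
  let ?t = "\<lambda>k. of_nat (p choose k) * x ^ k * y ^ (p - k)"
  have "p \<ge> 2" using p by (rule prime_ge_2_nat)
  then have "{..p} = insert 0 (insert p {1..<p})" by auto
  moreover have "(x + y) ^ p = (\<Sum>k\<le>p. ?t k)" by (rule binomial_ring)
  ultimately have "(x + y) ^ p - (x ^ p + y ^ p) = (\<Sum>k\<in>{1..<p}. ?t k)"
    using \<open>p \<ge> 2\<close> by simp
  moreover have "algebraic_int (?t k / of_nat p)" if "k \<in> {1..<p}" for k
  proof -
    have "p dvd p choose k" using that p by (intro dvd_choose_prime) auto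
    then obtain q where "p choose k = p * q" by blast
    then have "?t k / of_nat p = of_nat q * x ^ k * y ^ (p - k)" using \<open>p \<ge> 2\<close> by simp
    then show ?thesis
      using x y
      by (simp only:)
        (intro algebraic_int_mult algebraic_int_power, simp add: int_imp_algebraic_int)
  qed
  then have "algebraic_int (\<Sum>k\<in>{1..<p}. ?t k / of_nat p)" by (rule algebraic_int_sum)
  ultimately show ?thesis
    unfolding algebraic_int_cong_def by (simp only: sum_divide_distrib)
qed

lemma algebraic_int_cong_frobenius_sum:
  assumes p: "prime p" and f: "\<And>i. i \<in> I \<Longrightarrow> algebraic_int (f i)"
  shows "algebraic_int_cong p (sum f I ^ p) (\<Sum>i\<in>I. f i ^ p)"
  using f
proof (induction I rule: infinite_finite_induct)
  case (insert i I)
  have "algebraic_int_cong p ((f i + sum f I) ^ p) (f i ^ p + sum f I ^ p)"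
    using insert.prems by (intro algebraic_int_cong_frobenius_add p algebraic_int_sum) auto
  also have "algebraic_int_cong p \<dots> (f i ^ p + (\<Sum>i\<in>I. f i ^ p))"
    using insert.IH insert.prems by (intro algebraic_int_cong_add algebraic_int_cong_refl) auto
  finally show ?case using insert.hyps by simp
qed (use p in \<open>simp_all add: algebraic_int_cong_refl prime_gt_0_nat zero_power\<close>)

lemma algebraic_int_cong_fermat:
  assumes p: "prime p" and z: "z \<in> \<int>"
  shows "algebraic_int_cong p (z ^ p) z"
proof -
  have step: "algebraic_int_cong p (of_int (i + 1) ^ p) (of_int i ^ p + 1)" for i
    using algebraic_int_cong_frobenius_add[OF p, of "of_int i" 1]
    by (simp add: int_imp_algebraic_int)
  obtain m where m: "z = of_int m" using z by (rule Ints_cases)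
  have "algebraic_int_cong p (of_int m ^ p) (of_int m)"
  proof (induction m rule: int_induct[where k = 0])
    case base
    show ?case using p by (simp add: algebraic_int_cong_refl prime_gt_0_nat zero_power)
  next
    case (step1 i)
    note step[of i]
    also have "algebraic_int_cong p (of_int i ^ p + 1) (of_int i + 1)"
      by (intro algebraic_int_cong_add step1 algebraic_int_cong_refl)
    finally show ?case by simp
  next
    case (step2 i)
    have "algebraic_int_cong p (of_int (i - 1) ^ p + 1) (of_int i ^ p)"
      using algebraic_int_cong_sym[OF step[of "i - 1"]] by simp
    also note step2(2)
    finally have "algebraic_int_cong p (of_int (i - 1) ^ p + 1 + (-1)) (of_int i + (-1))"
      by (intro algebraic_int_cong_add algebraic_int_cong_refl)
    then show ?case by simp
  qed
  then show ?thesis by (simp add: m)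
qed

lemma algebraic_int_cong_Ints_imp_eq:
  assumes cong: "algebraic_int_cong m x y" and int: "x \<in> \<int>" "y \<in> \<int>"
    and bound: "cmod x + cmod y < real m"
  shows "x = y"
proof -
  have "x - y \<in> \<rat>" using int by (intro Rats_diff) (auto elim!: Ints_cases)
  then have "(x - y) / of_nat m \<in> \<int>"
    using cong unfolding algebraic_int_cong_def
    by (intro rational_algebraic_int_is_int Rats_divide) auto
  then obtain k where k: "(x - y) / of_nat m = of_int k" by (rule Ints_cases)
  have m: "real m > 0" using bound norm_ge_zero[of x] norm_ge_zero[of y] by linarith
  have "real_of_int \<bar>k\<bar> = cmod ((x - y) / of_nat m)" by (simp add: k)
  also have "\<dots> = cmod (x - y) / real m" by (simp add: norm_divide)
  also have "\<dots> < 1" using norm_triangle_ineq4[of x y] bound m by (simp add: divide_less_eq)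
  finally have "k = 0" by simp
  then show ?thesis using k m by simp
qed


section \<open>Characters of finite abelian groups\<close>

lemma sum_power_roots_of_unity:
  fixes k n :: nat
  assumes "k < n"
  shows "(\<Sum>z | z ^ n = (1::complex). z ^ k) = (if k = 0 then of_nat n else 0)"
proof (cases "k = 0")
  case True
  then show ?thesis using assms by (simp add: card_roots_unity_eq)
next
  case False
  let ?\<omega> = "\<lambda>j. cis (2 * pi * real j / real n)"
  have bij: "bij_betw ?\<omega> {..<n} {z. z ^ n = 1}"
    using assms by (intro bij_betw_roots_unity) simp
  then have "?\<omega> k ^ n = 1" using assms by (auto simp: bij_betw_def)
  moreover have "?\<omega> k \<noteq> ?\<omega> 0"
    using inj_onD[OF bij_betw_imp_inj_on[OF bij], of k 0] assms False by auto
  moreover have "(\<Sum>z | z ^ n = 1. z ^ k) = (\<Sum>j<n. ?\<omega> j ^ k)"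
    by (rule sum.reindex_bij_betw[OF bij, symmetric])
  moreover have "?\<omega> j ^ k = ?\<omega> k ^ j" for j by (simp add: DeMoivre mult_ac)
  ultimately show ?thesis using False by (simp add: geometric_sum)
qed

locale finite_comm_group = comm_group +
  assumes finite_carrier: "finite (carrier G)"
begin

lemma order_pos: "order G > 0"
  using finite_carrier by (simp add: order_gt_0_iff_finite)

abbreviation characters :: "('a \<Rightarrow> complex) set" where
  "characters \<equiv> hom G complex_units"

abbreviation conj_character :: "('a \<Rightarrow> complex) \<Rightarrow> 'a \<Rightarrow> complex" where
  "conj_character \<pi> \<equiv> \<lambda>a. cnj (\<pi> a)"

definition character_sum :: "('a \<Rightarrow> complex) \<Rightarrow> ('a \<Rightarrow> complex) \<Rightarrow> complex" where
  "character_sum F \<pi> = (\<Sum>a\<in>carrier G. F a * \<pi> a)"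

lemma charactersI:
  assumes "\<And>a. a \<in> carrier G \<Longrightarrow> \<pi> a \<noteq> 0"
    and "\<And>a b. a \<in> carrier G \<Longrightarrow> b \<in> carrier G \<Longrightarrow> \<pi> (a \<otimes> b) = \<pi> a * \<pi> b"
  shows "\<pi> \<in> characters"
  using assms by (auto simp: hom_def complex_units_def)

lemma character_mult:
  "\<lbrakk>\<pi> \<in> characters; a \<in> carrier G; b \<in> carrier G\<rbrakk> \<Longrightarrow> \<pi> (a \<otimes> b) = \<pi> a * \<pi> b"
  by (auto simp: hom_def complex_units_def)

lemma character_nonzero: "\<lbrakk>\<pi> \<in> characters; a \<in> carrier G\<rbrakk> \<Longrightarrow> \<pi> a \<noteq> 0"
  by (auto simp: hom_def complex_units_def)

lemma character_one: "\<pi> \<in> characters \<Longrightarrow> \<pi> \<one> = 1"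
  using character_mult[of \<pi> \<one> \<one>] character_nonzero[of \<pi> \<one>] by simp

lemma character_pow:
  assumes "\<pi> \<in> characters" "a \<in> carrier G"
  shows "\<pi> (a [^] (n::nat)) = \<pi> a ^ n"
  using assms by (induction n) (auto simp: character_one character_mult mult.commute)

lemma character_pow_order:
  "\<lbrakk>\<pi> \<in> characters; a \<in> carrier G\<rbrakk> \<Longrightarrow> \<pi> a ^ order G = 1"
  using pow_order_eq_1 by (metis character_one character_pow)

lemma norm_character: "\<lbrakk>\<pi> \<in> characters; a \<in> carrier G\<rbrakk> \<Longrightarrow> cmod (\<pi> a) = 1"
  using character_pow_order order_pos by (metis less_numeral_extra(3) power_eq_1_iff)

lemma algebraic_int_character:
  "\<lbrakk>\<pi> \<in> characters; a \<in> carrier G\<rbrakk> \<Longrightarrow> algebraic_int (\<pi> a)"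
  using character_pow_order order_pos by (rule algebraic_int_root_of_unity)

lemma character_mult_cnj:
  "\<lbrakk>\<pi> \<in> characters; a \<in> carrier G\<rbrakk> \<Longrightarrow> \<pi> a * cnj (\<pi> a) = 1"
  using norm_character by (simp flip: complex_norm_square)

lemma character_inv:
  assumes "\<pi> \<in> characters" "a \<in> carrier G"
  shows "\<pi> (inv a) = cnj (\<pi> a)"
proof -
  have "\<pi> a * \<pi> (inv a) = \<pi> a * cnj (\<pi> a)"
    using assms by (simp add: character_mult_cnj character_one flip: character_mult)
  then show ?thesis using character_nonzero[OF assms] by simp
qed

lemma conj_character_in_characters: "\<pi> \<in> characters \<Longrightarrow> conj_character \<pi> \<in> characters"
  by (intro charactersI) (auto simp: character_nonzero character_mult)

lemma character_compose_pow:
  "\<pi> \<in> characters \<Longrightarrow> (\<lambda>a. \<pi> (a [^] (n::nat))) \<in> characters"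
  by (intro charactersI) (auto simp: character_nonzero character_mult pow_mult_distrib m_comm)

lemma sum_translate:
  assumes "a \<in> carrier G"
  shows "(\<Sum>b\<in>carrier G. h (a \<otimes> b)) = (\<Sum>b\<in>carrier G. h b)"
proof (rule sum.reindex_bij_witness[of _ "\<lambda>b. inv a \<otimes> b" "\<lambda>b. a \<otimes> b"])
qed (use assms in \<open>auto simp: m_assoc[symmetric]\<close>)

lemma character_sum_translate:
  assumes \<pi>: "\<pi> \<in> characters" and a: "a \<in> carrier G"
  shows "character_sum (\<lambda>b. F (a \<otimes> b)) \<pi> = cnj (\<pi> a) * character_sum F \<pi>"
proof -
  have "F (a \<otimes> b) * \<pi> b = cnj (\<pi> a) * (F (a \<otimes> b) * \<pi> (a \<otimes> b))" if "b \<in> carrier G" for b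
    using character_mult_cnj[OF \<pi> a] that a \<pi> by (simp add: character_mult mult_ac)
  then have "character_sum (\<lambda>b. F (a \<otimes> b)) \<pi> =
      cnj (\<pi> a) * (\<Sum>b\<in>carrier G. F (a \<otimes> b) * \<pi> (a \<otimes> b))"
    unfolding character_sum_def sum_distrib_left by (rule sum.cong[OF refl])
  then show ?thesis
    unfolding character_sum_def sum_translate[OF a, of "\<lambda>b. F b * \<pi> b"] .
qed

text \<open>
  Up to the factor \<open>order G\<close>, the projection of \<open>F\<close> to the \<open>z\<^sup>-\<^sup>1\<close>-eigenspace of translation by \<open>a\<close>.
\<close>

definition translation_eigenpart :: "'a \<Rightarrow> complex \<Rightarrow> ('a \<Rightarrow> complex) \<Rightarrow> 'a \<Rightarrow> complex" where
  "translation_eigenpart a z F d = (\<Sum>k < order G. z ^ k * F (a [^] k \<otimes> d))"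

lemma translation_eigenpart_translate:
  assumes z: "z ^ order G = 1" and a: "a \<in> carrier G" and d: "d \<in> carrier G"
  shows "z * translation_eigenpart a z F (a \<otimes> d) = translation_eigenpart a z F d"
proof -
  define h where "h = (\<lambda>k. z ^ k * F (a [^] k \<otimes> d))"
  have "z * translation_eigenpart a z F (a \<otimes> d) = (\<Sum>k < order G. h (Suc k))"
    using a d by (simp add: translation_eigenpart_def h_def sum_distrib_left m_assoc mult_ac)
  also have "\<dots> = (\<Sum>k < order G. h k) + h (order G) - h 0"
    using sum.lessThan_Suc_shift[of h "order G"] by simp
  also have "\<dots> = (\<Sum>k < order G. h k)"
    using z pow_order_eq_1[OF a] by (simp add: h_def)
  finally show ?thesis by (simp add: translation_eigenpart_def h_def)
qed

lemma sum_translation_eigenpart: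
  assumes "d \<in> carrier G"
  shows "(\<Sum>z | z ^ order G = 1. translation_eigenpart a z F d) = of_nat (order G) * F d"
proof -
  have "(\<Sum>z | z ^ order G = 1. translation_eigenpart a z F d) =
      (\<Sum>k < order G. (\<Sum>z | z ^ order G = 1. z ^ k) * F (a [^] k \<otimes> d))"
    unfolding translation_eigenpart_def by (subst sum.swap) (simp add: sum_distrib_right)
  also have "\<dots> = (\<Sum>k < order G. if k = 0 then of_nat (order G) * F (a [^] k \<otimes> d) else 0)"
    by (intro sum.cong) (auto simp: sum_power_roots_of_unity)
  also have "\<dots> = of_nat (order G) * F d"
    using order_pos assms by simp
  finally show ?thesis .
qed

lemma character_sum_translation_eigenpart:
  assumes \<pi>: "\<pi> \<in> characters" and a: "a \<in> carrier G"
  shows "character_sum (translation_eigenpart a z F) \<pi> =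
    (\<Sum>k < order G. (z * cnj (\<pi> a)) ^ k) * character_sum F \<pi>"
proof -
  have "character_sum (translation_eigenpart a z F) \<pi> =
      (\<Sum>k < order G. z ^ k * character_sum (\<lambda>d. F (a [^] k \<otimes> d)) \<pi>)"
    unfolding character_sum_def translation_eigenpart_def sum_distrib_right
    by (subst sum.swap) (simp add: sum_distrib_left mult.assoc)
  also have "\<dots> = (\<Sum>k < order G. (z * cnj (\<pi> a)) ^ k) * character_sum F \<pi>"
    using a \<pi>
    by (simp add: character_sum_translate character_pow power_mult_distrib sum_distrib_right
        mult.assoc)
  finally show ?thesis .
qed

definition translation_eigenfunction :: "'a \<Rightarrow> ('a \<Rightarrow> complex) \<Rightarrow> bool" where
  "translation_eigenfunction b F \<longleftrightarrow> (\<exists>\<theta>. \<theta> \<noteq> 0 \<and> (\<forall>d\<in>carrier G. F (b \<otimes> d) = \<theta> * F d))"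

lemma translation_eigenfunction_eigenpart:
  assumes "translation_eigenfunction b F" and a: "a \<in> carrier G" and b: "b \<in> carrier G"
  shows "translation_eigenfunction b (translation_eigenpart a z F)"
proof -
  obtain \<theta> where \<theta>: "\<theta> \<noteq> 0" "\<And>d. d \<in> carrier G \<Longrightarrow> F (b \<otimes> d) = \<theta> * F d"
    using assms(1) unfolding translation_eigenfunction_def by blast
  have "F (a [^] k \<otimes> (b \<otimes> d)) = \<theta> * F (a [^] k \<otimes> d)" if "d \<in> carrier G" for d and k :: nat
    using \<theta>(2)[of "a [^] k \<otimes> d"] that a b by (simp add: m_lcomm)
  then have "translation_eigenpart a z F (b \<otimes> d) = \<theta> * translation_eigenpart a z F d"
    if "d \<in> carrier G" for d
    using that by (simp add: translation_eigenpart_def sum_distrib_left mult_ac)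
  with \<theta>(1) show ?thesis unfolding translation_eigenfunction_def by blast
qed

lemma exists_common_translation_eigenfunction:
  assumes "finite B" "B \<subseteq> carrier G" and F: "\<exists>d\<in>carrier G. F d \<noteq> 0"
  shows "\<exists>H. (\<exists>d\<in>carrier G. H d \<noteq> 0) \<and> (\<forall>b\<in>B. translation_eigenfunction b H) \<and>
    (\<forall>\<pi>\<in>characters. character_sum F \<pi> = 0 \<longrightarrow> character_sum H \<pi> = 0)"
  using assms(1,2)
proof (induction B)
  case empty
  then show ?case using F by blast
next
  case (insert a B)
  then have a: "a \<in> carrier G" by simp
  from insert obtain H d where d: "d \<in> carrier G" "H d \<noteq> 0"
    and H: "\<forall>b\<in>B. translation_eigenfunction b H"
      "\<forall>\<pi>\<in>characters. character_sum F \<pi> = 0 \<longrightarrow> character_sum H \<pi> = 0" by auto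
  have "(\<Sum>z | z ^ order G = 1. translation_eigenpart a z H d) \<noteq> 0"
    using d order_pos by (simp add: sum_translation_eigenpart)
  then obtain z where z: "z ^ order G = 1" "translation_eigenpart a z H d \<noteq> 0"
    by (metis (mono_tags, lifting) mem_Collect_eq sum.neutral)
  let ?K = "translation_eigenpart a z H"
  have "z \<noteq> 0" using z(1) order_pos by (metis less_numeral_extra(3) power_0_left zero_neq_one)
  then have "?K (a \<otimes> d) = inverse z * ?K d" if "d \<in> carrier G" for d
    using translation_eigenpart_translate[OF z(1) a that, of H, symmetric] by simp
  then have "translation_eigenfunction a ?K"
    unfolding translation_eigenfunction_def using \<open>z \<noteq> 0\<close> by (intro exI[of _ "inverse z"]) simp
  moreover have "translation_eigenfunction b ?K" if "b \<in> B" for b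
    using that H(1) insert.prems a by (intro translation_eigenfunction_eigenpart) auto
  ultimately show ?case
    using z(2) d(1) H(2) a by (intro exI[of _ ?K]) (auto simp: character_sum_translation_eigenpart)
qed

lemma common_translation_eigenfunction_imp_character:
  assumes H: "\<exists>d\<in>carrier G. H d \<noteq> 0" and eig: "\<forall>b\<in>carrier G. translation_eigenfunction b H"
  obtains \<chi> where "\<chi> \<in> characters" "\<forall>d\<in>carrier G. H d = \<chi> d * H \<one>" "H \<one> \<noteq> 0"
proof -
  obtain \<chi> where \<chi>: "\<And>b. b \<in> carrier G \<Longrightarrow> \<chi> b \<noteq> 0"
    "\<And>b d. b \<in> carrier G \<Longrightarrow> d \<in> carrier G \<Longrightarrow> H (b \<otimes> d) = \<chi> b * H d"
    using eig unfolding translation_eigenfunction_def by metis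
  have scalar: "H d = \<chi> d * H \<one>" if "d \<in> carrier G" for d
    using \<chi>(2)[of d \<one>] that by simp
  with H have nonzero: "H \<one> \<noteq> 0" by (metis mult_zero_right)
  have "\<chi> \<in> characters"
  proof (rule charactersI)
    fix a b assume ab: "a \<in> carrier G" "b \<in> carrier G"
    have "\<chi> (a \<otimes> b) * H \<one> = H (a \<otimes> b)" using scalar[of "a \<otimes> b"] ab by simp
    also have "\<dots> = \<chi> a * H b" using ab by (rule \<chi>(2))
    also have "\<dots> = \<chi> a * \<chi> b * H \<one>" using scalar[OF ab(2)] by simp
    finally show "\<chi> (a \<otimes> b) = \<chi> a * \<chi> b" using nonzero by simp
  qed (rule \<chi>(1))
  with scalar nonzero show thesis by (intro that) blast+
qed

theorem character_completeness:
  assumes "\<And>\<pi>. \<pi> \<in> characters \<Longrightarrow> character_sum F \<pi> = 0" and "a \<in> carrier G"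
  shows "F a = 0"
proof (rule ccontr)
  assume "F a \<noteq> 0"
  then have "\<exists>d\<in>carrier G. F d \<noteq> 0" using assms(2) by blast
  then obtain H where H: "\<exists>d\<in>carrier G. H d \<noteq> 0" "\<forall>b\<in>carrier G. translation_eigenfunction b H"
    "\<forall>\<pi>\<in>characters. character_sum H \<pi> = 0"
    using exists_common_translation_eigenfunction[OF finite_carrier subset_refl, of F] assms(1)
    by blast
  obtain \<chi> where \<chi>: "\<chi> \<in> characters" "\<forall>d\<in>carrier G. H d = \<chi> d * H \<one>" "H \<one> \<noteq> 0"
    using H(1,2) by (rule common_translation_eigenfunction_imp_character)
  have "H d * cnj (\<chi> d) = H \<one>" if "d \<in> carrier G" for d
    using character_mult_cnj[OF \<chi>(1) that] by (simp add: bspec[OF \<chi>(2) that] mult_ac)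
  then have "character_sum H (conj_character \<chi>) = of_nat (order G) * H \<one>"
    by (simp add: character_sum_def order_def)
  then show False using H(3) conj_character_in_characters[OF \<chi>(1)] \<chi>(3) order_pos by simp
qed

corollary character_sums_determine:
  assumes "\<And>\<pi>. \<pi> \<in> characters \<Longrightarrow> character_sum F \<pi> = character_sum H \<pi>" and "a \<in> carrier G"
  shows "F a = H a"
  using character_completeness[of "\<lambda>a. F a - H a" a] assms
  by (simp add: character_sum_def left_diff_distrib sum_subtractf)

end


section \<open>Integrality of character sums\<close>

lemma exists_coprime_cong_nat:
  fixes k m N :: nat
  assumes km: "coprime k m" and N: "N > 0"
  obtains k' where "[k' = k] (mod m)" "coprime k' N"
proof -
  define Q where "Q = \<Prod>{p \<in> prime_factors N. \<not> p dvd k}"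
  have "\<not> p dvd k + m * Q" if p: "p \<in> prime_factors N" for p
  proof (cases "p dvd k")
    case True
    have "prime p" using p by auto
    then have "\<not> p dvd m" using True km by (metis coprime_common_divisor not_prime_unit)
    moreover have "\<not> p dvd q" if "q \<in> prime_factors N" "\<not> q dvd k" for q
      using that True \<open>prime p\<close> by (metis in_prime_factors_imp_prime primes_dvd_imp_eq)
    then have "\<not> p dvd Q"
      unfolding Q_def using \<open>prime p\<close> by (subst prime_dvd_prod_iff) auto
    ultimately show ?thesis
      using True \<open>prime p\<close> by (simp add: dvd_add_right_iff prime_dvd_mult_iff)
  next
    case False
    then have "p dvd Q" unfolding Q_def using p by (intro dvd_prodI) auto
    then show ?thesis using False by (simp add: dvd_add_left_iff)
  qed
  moreover have "\<exists>p \<in> prime_factors N. p dvd k + m * Q" if "\<not> coprime (k + m * Q) N"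
  proof -
    have "gcd (k + m * Q) N \<noteq> 1" using that by (simp add: coprime_iff_gcd_eq_1)
    then show ?thesis
      using prime_factor_nat[of "gcd (k + m * Q) N"] N by (auto simp: in_prime_factors_iff)
  qed
  ultimately have "coprime (k + m * Q) N" by blast
  then show thesis by (intro that[of "k + m * Q"]) (auto simp: cong_def)
qed

context finite_comm_group
begin

definition constant_on_atoms :: "('a \<Rightarrow> 'c) \<Rightarrow> bool" where
  "constant_on_atoms F \<longleftrightarrow>
    (\<forall>a\<in>carrier G. \<forall>b\<in>carrier G. generate G {a} = generate G {b} \<longrightarrow> F a = F b)"

lemma algebraic_int_character_sum:
  assumes "F \<in> carrier G \<rightarrow> \<int>" and "\<pi> \<in> characters"
  shows "algebraic_int (character_sum F \<pi>)"
  unfolding character_sum_def using assms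
  by (intro algebraic_int_sum algebraic_int_mult algebraic_int_character int_imp_algebraic_int) auto

lemma norm_character_sum_le:
  assumes "\<pi> \<in> characters"
  shows "cmod (character_sum F \<pi>) \<le> (\<Sum>a\<in>carrier G. cmod (F a))"
proof -
  have "cmod (character_sum F \<pi>) \<le> (\<Sum>a\<in>carrier G. cmod (F a * \<pi> a))"
    unfolding character_sum_def by (rule norm_sum)
  then show ?thesis using norm_character[OF assms] by (simp add: norm_mult)
qed

lemma character_sum_frobenius_cong:
  assumes p: "prime p" and F: "F \<in> carrier G \<rightarrow> \<int>" and \<pi>: "\<pi> \<in> characters"
  shows "algebraic_int_cong p (character_sum F \<pi> ^ p) (character_sum F (\<lambda>a. \<pi> (a [^] p)))"
proof -
  have summand: "algebraic_int_cong p ((F a * \<pi> a) ^ p) (F a * \<pi> (a [^] p))"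
    if a: "a \<in> carrier G" for a
  proof -
    have "algebraic_int_cong p (F a ^ p * \<pi> a ^ p) (F a * \<pi> a ^ p)"
      using F a \<pi> p
      by (intro algebraic_int_cong_mult_right algebraic_int_cong_fermat algebraic_int_power
          algebraic_int_character) auto
    then show ?thesis using a \<pi> by (simp add: power_mult_distrib character_pow)
  qed
  have "algebraic_int_cong p (character_sum F \<pi> ^ p) (\<Sum>a\<in>carrier G. (F a * \<pi> a) ^ p)"
    unfolding character_sum_def using F \<pi>
    by (intro algebraic_int_cong_frobenius_sum p algebraic_int_mult algebraic_int_character
        int_imp_algebraic_int) auto
  also have "algebraic_int_cong p \<dots> (character_sum F (\<lambda>a. \<pi> (a [^] p)))"
    unfolding character_sum_def by (intro algebraic_int_cong_sum summand)
  finally show ?thesis .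
qed

lemma character_sum_compose_prime_pow:
  assumes p: "prime p" "2 * (\<Sum>a\<in>carrier G. cmod (F a)) < real p"
    and F: "F \<in> carrier G \<rightarrow> \<int>"
    and int: "\<And>\<pi>. \<pi> \<in> characters \<Longrightarrow> character_sum F \<pi> \<in> \<int>"
    and \<pi>: "\<pi> \<in> characters"
  shows "character_sum F (\<lambda>a. \<pi> (a [^] p)) = character_sum F \<pi>"
proof (rule algebraic_int_cong_Ints_imp_eq)
  let ?\<pi>p = "\<lambda>a. \<pi> (a [^] p)"
  have \<pi>p: "?\<pi>p \<in> characters" using \<pi> by (rule character_compose_pow)
  show "algebraic_int_cong p (character_sum F ?\<pi>p) (character_sum F \<pi>)"
    using character_sum_frobenius_cong[OF p(1) F \<pi>] algebraic_int_cong_fermat[OF p(1) int[OF \<pi>]]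
    by (blast intro: algebraic_int_cong_sym algebraic_int_cong_trans)
  show "character_sum F ?\<pi>p \<in> \<int>" "character_sum F \<pi> \<in> \<int>"
    by (intro int \<pi>p \<pi>)+
  show "cmod (character_sum F ?\<pi>p) + cmod (character_sum F \<pi>) < real p"
    using norm_character_sum_le[OF \<pi>p, of F] norm_character_sum_le[OF \<pi>, of F] p(2) by linarith
qed

lemma character_sum_compose_pow:
  assumes k: "k > 0" "\<And>p. prime p \<Longrightarrow> p dvd k \<Longrightarrow> 2 * (\<Sum>a\<in>carrier G. cmod (F a)) < real p"
    and F: "F \<in> carrier G \<rightarrow> \<int>"
    and int: "\<And>\<pi>. \<pi> \<in> characters \<Longrightarrow> character_sum F \<pi> \<in> \<int>"
    and \<pi>: "\<pi> \<in> characters"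
  shows "character_sum F (\<lambda>a. \<pi> (a [^] k)) = character_sum F \<pi>"
  using k
proof (induction k rule: prime_divisors_induct)
  case (unit k)
  then show ?case by (simp add: character_sum_def)
next
  case (factor p m)
  have "character_sum F (\<lambda>a. \<pi> (a [^] (p * m))) =
      character_sum F (\<lambda>a. (\<lambda>b. \<pi> (b [^] m)) (a [^] p))"
    by (simp add: character_sum_def nat_pow_pow)
  also have "\<dots> = character_sum F (\<lambda>a. \<pi> (a [^] m))"
    using factor.hyps factor.prems(2)
    by (intro character_sum_compose_prime_pow F int character_compose_pow \<pi>) auto
  also have "\<dots> = character_sum F \<pi>"
    using factor.prems by (intro factor.IH) auto
  finally show ?case .
qed simp

lemma nat_pow_cong_ord:
  assumes "a \<in> carrier G" "[k = l] (mod ord a)"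
  shows "a [^] k = a [^] l"
proof -
  have "int (ord a) dvd int l - int k"
    using assms(2) by (metis cong_iff_dvd_diff cong_int_iff cong_sym)
  then show ?thesis
    using int_pow_eq[OF assms(1), of "int k" "int l"] by (simp add: int_pow_int)
qed

lemma generate_eq_imp_coprime_pow:
  assumes a: "a \<in> carrier G" and b: "b \<in> carrier G" and eq: "generate G {a} = generate G {b}"
  obtains k :: nat where "b = a [^] k" "coprime k (ord a)"
proof -
  have "b \<in> generate G {a}" unfolding eq by (auto intro: generate.incl)
  then obtain k :: nat where k: "b = a [^] k"
    using generate_pow_on_finite_carrier[OF finite_carrier a] by auto
  have "ord b = ord a" using a b eq by (metis generate_pow_card)
  then have "coprime k (ord a)"
    unfolding k using pow_ord_eq_ord_iff[OF finite_carrier a] by blast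
  with k show thesis by (rule that)
qed

lemma coprime_order_imp_pow_inverse:
  assumes "coprime k (order G)"
  obtains u :: nat where "\<forall>a\<in>carrier G. a [^] (k * u) = a"
proof -
  obtain u where u: "[k * u = 1] (mod order G)"
    using cong_solve_coprime_nat[OF assms] by auto
  have "a [^] (k * u) = a" if a: "a \<in> carrier G" for a
    using nat_pow_cong_ord[OF a, of "k * u" 1] u ord_dvd_group_order[OF a] a
    by (simp add: cong_dvd_modulus_nat)
  then show thesis by (intro that) blast
qed

lemma character_sums_pow_invariant_imp_pow_invariant:
  assumes k: "coprime k (order G)"
    and inv: "\<And>\<pi>. \<pi> \<in> characters \<Longrightarrow>
      character_sum F (\<lambda>a. \<pi> (a [^] k)) = character_sum F \<pi>"
    and a: "a \<in> carrier G"
  shows "F (a [^] k) = F a"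
proof -
  obtain u where u: "\<forall>d\<in>carrier G. d [^] (k * u) = d"
    using k by (rule coprime_order_imp_pow_inverse)
  have "F (d [^] u) = F d" if "d \<in> carrier G" for d
  proof (rule character_sums_determine[OF _ that])
    fix \<pi> assume \<pi>: "\<pi> \<in> characters"
    have "character_sum (\<lambda>d. F (d [^] u)) \<pi> = character_sum F (\<lambda>a. \<pi> (a [^] k))"
      unfolding character_sum_def
      by (rule sum.reindex_bij_witness[of _ "\<lambda>a. a [^] k" "\<lambda>d. d [^] u"])
        (auto simp: nat_pow_pow u mult.commute[of u])
    then show "character_sum (\<lambda>d. F (d [^] u)) \<pi> = character_sum F \<pi>"
      using inv[OF \<pi>] by simp
  qed
  from this[of "a [^] k"] show ?thesis using a by (simp add: nat_pow_pow u)
qed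

proposition integral_character_sums_imp_constant_on_atoms:
  assumes F: "F \<in> carrier G \<rightarrow> \<int>"
    and int: "\<And>\<pi>. \<pi> \<in> characters \<Longrightarrow> character_sum F \<pi> \<in> \<int>"
  shows "constant_on_atoms F"
  unfolding constant_on_atoms_def
proof (intro ballI impI)
  fix a b assume a: "a \<in> carrier G" and b: "b \<in> carrier G"
    and "generate G {a} = generate G {b}"
  then obtain k where k: "b = a [^] k" "coprime k (ord a)"
    by (rule generate_eq_imp_coprime_pow)
  define N where "N = nat \<lceil>2 * (\<Sum>a\<in>carrier G. cmod (F a))\<rceil> + 2"
  have bound: "2 * (\<Sum>a\<in>carrier G. cmod (F a)) < real N"
    using real_nat_ceiling_ge[of "2 * (\<Sum>a\<in>carrier G. cmod (F a))"] by (simp add: N_def)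
  obtain l where l: "[l = k] (mod ord a)" "coprime l (order G * fact N)"
    using exists_coprime_cong_nat[OF k(2), of "order G * fact N"] order_pos by auto
  have "b = a [^] l" using nat_pow_cong_ord[OF a l(1)] k(1) by simp
  have large: "N < p" if p: "prime p" "p dvd l" for p
  proof -
    have "\<not> p dvd fact N"
      using l(2) p by (metis coprime_common_divisor coprime_mult_right_iff not_prime_unit)
    then show ?thesis using p(1) by (simp add: prime_dvd_fact_iff)
  qed
  have "l > 0" using large[of 2] by (cases "l = 0") (auto simp: N_def)
  moreover have "2 * (\<Sum>a\<in>carrier G. cmod (F a)) < real p" if "prime p" "p dvd l" for p
    using bound large[OF that] by linarith
  ultimately have "F (a [^] l) = F a"
    using l(2) by (intro character_sums_pow_invariant_imp_pow_invariant[OF _ _ a]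
        character_sum_compose_pow F int) auto
  then show "F a = F b" unfolding \<open>b = a [^] l\<close> ..
qed

lemma character_sum_subgroup_Ints:
  assumes H: "subgroup H G" and \<pi>: "\<pi> \<in> characters"
  shows "(\<Sum>a\<in>H. \<pi> a) \<in> \<int>"
proof (cases "\<forall>h\<in>H. \<pi> h = 1")
  case True
  then show ?thesis by simp
next
  case False
  then obtain h where h: "h \<in> H" "\<pi> h \<noteq> 1" by blast
  interpret H: subgroup H G by (rule H)
  have "\<pi> h * (\<Sum>a\<in>H. \<pi> a) = (\<Sum>a\<in>H. \<pi> (h \<otimes> a))"
    unfolding sum_distrib_left using h \<pi> by (intro sum.cong) (auto simp: character_mult)
  also have "\<dots> = (\<Sum>a\<in>H. \<pi> a)"
    using h by (intro sum.reindex_bij_witness[of _ "\<lambda>b. inv h \<otimes> b" "\<lambda>b. h \<otimes> b"])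
      (auto simp: m_assoc[symmetric])
  finally show ?thesis using h(2) by simp
qed

lemma mem_own_atom: "a \<in> carrier G \<Longrightarrow> a \<in> atom G a"
  by (simp add: atom_def)

lemma atom_eqI: "b \<in> atom G a \<Longrightarrow> atom G b = atom G a"
  by (simp add: atom_def)

lemma mem_atoms_iff: "\<lbrakk>\<alpha> \<in> atoms G; a \<in> carrier G\<rbrakk> \<Longrightarrow> a \<in> \<alpha> \<longleftrightarrow> \<alpha> = atom G a"
  by (auto simp: atoms_def atom_def)

lemma sum_atoms:
  assumes "H \<subseteq> carrier G" and closed: "\<And>h. h \<in> H \<Longrightarrow> atom G h \<subseteq> H"
  shows "sum f H = (\<Sum>\<alpha>\<in>atom G ` H. sum f \<alpha>)"
proof -
  have finite: "finite H" using assms(1) finite_carrier by (rule finite_subset)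
  have "H = \<Union>(atom G ` H)" using assms mem_own_atom by blast
  then have "sum f H = sum f (\<Union>(atom G ` H))" by simp
  also have "\<dots> = (\<Sum>\<alpha>\<in>atom G ` H. sum f \<alpha>)"
  proof (subst sum.Union_disjoint)
    show "\<forall>\<alpha>\<in>atom G ` H. finite \<alpha>"
      using closed finite by (auto intro: finite_subset)
    show "\<forall>\<alpha>\<in>atom G ` H. \<forall>\<beta>\<in>atom G ` H. \<alpha> \<noteq> \<beta> \<longrightarrow> \<alpha> \<inter> \<beta> = {}"
      using atom_eqI by blast
  qed simp
  finally show ?thesis .
qed

lemma character_sum_atom_Ints:
  assumes \<pi>: "\<pi> \<in> characters" and g: "g \<in> carrier G"
  shows "(\<Sum>a\<in>atom G g. \<pi> a) \<in> \<int>"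
  using g
proof (induction "card (generate G {g})" arbitrary: g rule: less_induct)
  case less
  let ?H = "generate G {g}"
  have sub: "subgroup ?H G" using less.prems by (intro generate_is_subgroup) simp
  then have carrier: "?H \<subseteq> carrier G" by (rule subgroup.subset)
  then have finite: "finite ?H" using finite_carrier by (rule finite_subset)
  have le: "generate G {h} \<subseteq> ?H" if "h \<in> ?H" for h
    using that by (intro generate_subgroup_incl[OF _ sub]) simp
  have atom_le: "atom G h \<subseteq> ?H" if "h \<in> ?H" for h
  proof
    fix a assume "a \<in> atom G h"
    then have "a \<in> generate G {h}" by (auto simp: atom_def intro: generate.incl)
    then show "a \<in> ?H" using le[OF that] by blast
  qed
  have "(\<Sum>a\<in>?H. \<pi> a) = (\<Sum>\<alpha>\<in>atom G ` ?H. \<Sum>a\<in>\<alpha>. \<pi> a)"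
    using carrier atom_le by (rule sum_atoms)
  also have "\<dots> = (\<Sum>a\<in>atom G g. \<pi> a) + (\<Sum>\<alpha>\<in>atom G ` ?H - {atom G g}. \<Sum>a\<in>\<alpha>. \<pi> a)"
    using finite by (intro sum.remove) (auto intro: generate.incl)
  finally have "(\<Sum>a\<in>atom G g. \<pi> a) =
      (\<Sum>a\<in>?H. \<pi> a) - (\<Sum>\<alpha>\<in>atom G ` ?H - {atom G g}. \<Sum>a\<in>\<alpha>. \<pi> a)" by simp
  moreover have "(\<Sum>\<alpha>\<in>atom G ` ?H - {atom G g}. \<Sum>a\<in>\<alpha>. \<pi> a) \<in> \<int>"
  proof (rule Ints_sum)
    fix \<alpha> assume "\<alpha> \<in> atom G ` ?H - {atom G g}"
    then obtain h where h: "h \<in> ?H" "\<alpha> = atom G h" "atom G h \<noteq> atom G g" by auto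
    then have "generate G {h} \<subset> ?H" using le[OF h(1)] by (auto simp: atom_def)
    then have "card (generate G {h}) < card ?H" using finite by (rule psubset_card_mono[rotated])
    then show "(\<Sum>a\<in>\<alpha>. \<pi> a) \<in> \<int>" unfolding h(2) using h(1) carrier by (intro less.hyps) auto
  qed
  ultimately show ?case using character_sum_subgroup_Ints[OF sub \<pi>] by simp
qed

lemma constant_on_atoms_imp_integral_character_sum:
  assumes F: "F \<in> carrier G \<rightarrow> \<int>" and const: "constant_on_atoms F" and \<pi>: "\<pi> \<in> characters"
  shows "character_sum F \<pi> \<in> \<int>"
proof -
  have atom_Ints: "(\<Sum>a\<in>atom G h. F a * \<pi> a) \<in> \<int>" if h: "h \<in> carrier G" for h
  proof -
    have "F a = F h" if "a \<in> atom G h" for a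
      using const that h unfolding constant_on_atoms_def atom_def by blast
    then have "(\<Sum>a\<in>atom G h. F a * \<pi> a) = F h * (\<Sum>a\<in>atom G h. \<pi> a)"
      unfolding sum_distrib_left by (intro sum.cong refl arg_cong2[where f = "(*)"])
    moreover have "F h \<in> \<int>" using F h by blast
    ultimately show ?thesis using character_sum_atom_Ints[OF \<pi> h] by simp
  qed
  have "(\<Sum>\<alpha>\<in>atom G ` carrier G. \<Sum>a\<in>\<alpha>. F a * \<pi> a) \<in> \<int>"
    by (rule Ints_sum) (auto intro: atom_Ints)
  then show ?thesis
    unfolding character_sum_def by (subst sum_atoms) (auto simp: atom_def)
qed

lemma atomic_mset_imp_constant_on_atoms:
  assumes "mk_mset (carrier G) L \<in> atomic_msets G"
  shows "constant_on_atoms L"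
proof -
  obtain T f where T: "T \<subseteq> atoms G" "\<forall>\<alpha>\<in>T. \<exists>c. \<forall>a\<in>\<alpha>. f \<alpha> a = c"
    and eq: "mk_mset (carrier G) L = mset_sum (\<lambda>\<alpha>. mk_mset \<alpha> (f \<alpha>)) T"
    using assms by (auto simp: atomic_msets_def)
  have L: "L a = (\<Sum>\<alpha>\<in>T. if a \<in> \<alpha> then f \<alpha> a else 0)" if "a \<in> carrier G" for a
  proof -
    have "mset_mult (mk_mset (carrier G) L) a =
        mset_mult (mset_sum (\<lambda>\<alpha>. mk_mset \<alpha> (f \<alpha>)) T) a"
      unfolding eq ..
    moreover have "a \<in> \<Union>T" using that eq by (auto simp: mk_mset_def mset_sum_def)
    ultimately show ?thesis using that
      by (simp add: mset_sum_def mk_mset_def mset_mult_def cong: sum.cong if_cong)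
  qed
  have "L a = L b" if a: "a \<in> carrier G" and b: "b \<in> carrier G"
    and gen: "generate G {a} = generate G {b}" for a b
    unfolding L[OF a] L[OF b]
  proof (rule sum.cong[OF refl])
    fix \<alpha> assume \<alpha>: "\<alpha> \<in> T"
    then have "a \<in> \<alpha> \<longleftrightarrow> b \<in> \<alpha>" using T(1) a b gen by (auto simp: atoms_def atom_def)
    then show "(if a \<in> \<alpha> then f \<alpha> a else 0) = (if b \<in> \<alpha> then f \<alpha> b else 0)"
      using T(2) \<alpha> by auto
  qed
  then show ?thesis unfolding constant_on_atoms_def by blast
qed

lemma constant_on_atoms_imp_atomic_mset:
  assumes "constant_on_atoms L"
  shows "mk_mset (carrier G) L \<in> atomic_msets G"
proof -
  have "(\<Sum>\<alpha>\<in>atoms G. if a \<in> \<alpha> then L a else 0) = L a" if a: "a \<in> carrier G" for a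
  proof -
    have "(\<Sum>\<alpha>\<in>atoms G. if a \<in> \<alpha> then L a else 0) =
        (\<Sum>\<alpha>\<in>atoms G. if \<alpha> = atom G a then L a else 0)"
      using a by (intro sum.cong) (auto simp: mem_atoms_iff)
    then show ?thesis using finite_carrier a by (simp add: atoms_def)
  qed
  moreover have "\<Union>(atoms G) = carrier G" by (auto simp: atoms_def atom_def)
  ultimately have "mk_mset (carrier G) L = mset_sum (\<lambda>\<alpha>. mk_mset \<alpha> L) (atoms G)"
    by (auto simp: mset_sum_def mk_mset_def mset_mult_def restrict_def fun_eq_iff cong: if_cong)
  moreover have "\<forall>\<alpha>\<in>atoms G. \<exists>c. \<forall>a\<in>\<alpha>. L a = c"
    using assms unfolding atoms_def atom_def constant_on_atoms_def by blast
  ultimately show ?thesis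
    unfolding atomic_msets_def by (intro CollectI exI[of _ "atoms G"] exI[of _ "\<lambda>_. L"]) simp
qed

theorem atomic_mset_iff_integral_character_sums:
  fixes L :: "'a \<Rightarrow> nat"
  shows "mk_mset (carrier G) L \<in> atomic_msets G \<longleftrightarrow>
    (\<forall>\<pi>\<in>characters. character_sum (\<lambda>a. of_nat (L a)) \<pi> \<in> \<int>)"
proof -
  let ?L = "\<lambda>a. of_nat (L a) :: complex"
  have "mk_mset (carrier G) L \<in> atomic_msets G \<longleftrightarrow> constant_on_atoms L"
    using atomic_mset_imp_constant_on_atoms constant_on_atoms_imp_atomic_mset by blast
  also have "\<dots> \<longleftrightarrow> constant_on_atoms ?L"
    by (simp add: constant_on_atoms_def)
  also have "\<dots> \<longleftrightarrow> (\<forall>\<pi>\<in>characters. character_sum ?L \<pi> \<in> \<int>)"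
    using integral_character_sums_imp_constant_on_atoms[of ?L]
      constant_on_atoms_imp_integral_character_sum[of ?L] by auto
  finally show ?thesis .
qed

end


section \<open>The spectrum of a dicyclic kernel\<close>

lemma homogeneous_system_2_solvable_iff:
  fixes p q r s :: "'a::idom"
  shows "(\<exists>x y. (x \<noteq> 0 \<or> y \<noteq> 0) \<and> p * x = q * y \<and> r * x = s * y) \<longleftrightarrow> p * s = q * r"
proof
  assume "\<exists>x y. (x \<noteq> 0 \<or> y \<noteq> 0) \<and> p * x = q * y \<and> r * x = s * y"
  then obtain x y where nonzero: "x \<noteq> 0 \<or> y \<noteq> 0" and eqs: "p * x = q * y" "r * x = s * y" by blast
  have "(p * s - q * r) * x = s * (p * x) - q * (r * x)" by (simp add: algebra_simps)
  also have "\<dots> = 0" unfolding eqs by (simp add: mult.left_commute)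
  finally have "p * s = q * r \<or> x = 0" by simp
  moreover have "(p * s - q * r) * y = p * (s * y) - r * (q * y)" by (simp add: algebra_simps)
  then have "(p * s - q * r) * y = 0" unfolding eqs[symmetric] by (simp add: mult.left_commute)
  ultimately show "p * s = q * r" using nonzero by auto
next
  assume det: "p * s = q * r"
  consider (first_equation) "q \<noteq> 0 \<or> p \<noteq> 0" | (second_equation) "s \<noteq> 0 \<or> r \<noteq> 0"
    | (zero) "p = 0" "q = 0" "r = 0" "s = 0" by blast
  then show "\<exists>x y. (x \<noteq> 0 \<or> y \<noteq> 0) \<and> p * x = q * y \<and> r * x = s * y"
  proof cases
    case first_equation
    then show ?thesis using det by (intro exI[of _ q] exI[of _ p]) (auto simp: mult_ac)
  next
    case second_equation
    then show ?thesis using det by (intro exI[of _ s] exI[of _ r]) (auto simp: mult_ac)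
  next
    case zero
    then show ?thesis by (intro exI[of _ 1]) auto
  qed
qed

lemma sum_Times_bool:
  assumes "finite C"
  shows "(\<Sum>v\<in>C \<times> UNIV. f v) = (\<Sum>b\<in>C. f (b, False)) + (\<Sum>b\<in>C. f (b, True))"
proof -
  have "(\<Sum>v\<in>C \<times> UNIV. f v) = (\<Sum>b\<in>C. \<Sum>q\<in>UNIV. f (b, q))"
    by (simp add: sum.cartesian_product)
  then show ?thesis by (simp add: UNIV_bool sum.distrib)
qed

lemma is_eigenvalue_cong:
  assumes "\<And>u v. u \<in> V \<Longrightarrow> v \<in> V \<Longrightarrow> M u v = N u v"
  shows "is_eigenvalue V M \<mu> \<longleftrightarrow> is_eigenvalue V N \<mu>"
  unfolding is_eigenvalue_def using assms by (simp cong: sum.cong)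

context finite_comm_group
begin

definition correlation :: "('a \<Rightarrow> complex) \<Rightarrow> ('a \<Rightarrow> complex) \<Rightarrow> 'a \<Rightarrow> complex" where
  "correlation h F a = (\<Sum>b\<in>carrier G. h (inv a \<otimes> b) * F b)"

definition reflected_correlation :: "('a \<Rightarrow> complex) \<Rightarrow> ('a \<Rightarrow> complex) \<Rightarrow> 'a \<Rightarrow> complex" where
  "reflected_correlation h F a = (\<Sum>b\<in>carrier G. h (a \<otimes> b) * F b)"

definition dicyclic_kernel ::
  "('a \<Rightarrow> complex) \<Rightarrow> ('a \<Rightarrow> complex) \<Rightarrow> 'a \<times> bool \<Rightarrow> 'a \<times> bool \<Rightarrow> complex" where
  "dicyclic_kernel L M u v =
    (if snd u = snd v then L (inv (fst u) \<otimes> fst v) else M (fst u \<otimes> fst v))"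

lemma reflected_correlation_character:
  assumes "\<pi> \<in> characters" "a \<in> carrier G"
  shows "reflected_correlation h (\<lambda>b. c * \<pi> b) a = c * cnj (\<pi> a) * character_sum h \<pi>"
proof -
  have "reflected_correlation h (\<lambda>b. c * \<pi> b) a = c * character_sum (\<lambda>b. h (a \<otimes> b)) \<pi>"
    by (simp add: reflected_correlation_def character_sum_def sum_distrib_left mult.left_commute)
  then show ?thesis using assms by (simp add: character_sum_translate)
qed

lemma correlation_character:
  "\<lbrakk>\<pi> \<in> characters; a \<in> carrier G\<rbrakk> \<Longrightarrow>
    correlation h (\<lambda>b. c * \<pi> b) a = c * \<pi> a * character_sum h \<pi>"
  using reflected_correlation_character[of \<pi> "inv a" h c]
  by (simp add: correlation_def reflected_correlation_def character_inv)

lemma character_sum_reflected_correlation: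
  assumes \<pi>: "\<pi> \<in> characters"
  shows "character_sum (reflected_correlation h F) \<pi> =
    character_sum F (conj_character \<pi>) * character_sum h \<pi>"
proof -
  have "character_sum (reflected_correlation h F) \<pi> =
      (\<Sum>b\<in>carrier G. F b * (\<Sum>a\<in>carrier G. h (a \<otimes> b) * \<pi> a))"
    unfolding character_sum_def reflected_correlation_def sum_distrib_right sum_distrib_left
    by (subst sum.swap) (simp add: mult_ac)
  also have "\<dots> = (\<Sum>b\<in>carrier G. F b * character_sum (\<lambda>a. h (b \<otimes> a)) \<pi>)"
    unfolding character_sum_def by (simp add: m_comm)
  also have "\<dots> = (\<Sum>b\<in>carrier G. F b * (cnj (\<pi> b) * character_sum h \<pi>))"
    by (simp add: character_sum_translate[OF \<pi>])
  finally show ?thesis by (simp add: character_sum_def[of F] sum_distrib_right mult.assoc)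
qed

lemma sum_inv: "(\<Sum>b\<in>carrier G. h (inv b)) = (\<Sum>b\<in>carrier G. h b)"
  by (rule sum.reindex_bij_witness[of _ "\<lambda>b. inv b" "\<lambda>b. inv b"]) auto

lemma character_sum_compose_inv:
  assumes "\<pi> \<in> characters"
  shows "character_sum (\<lambda>a. F (inv a)) \<pi> = character_sum F (conj_character \<pi>)"
  using sum_inv[of "\<lambda>a. F a * cnj (\<pi> a)"] assms
  by (simp add: character_sum_def character_inv)

lemma character_sum_correlation:
  assumes \<pi>: "\<pi> \<in> characters"
  shows "character_sum (correlation h F) \<pi> =
    character_sum F \<pi> * character_sum h (conj_character \<pi>)"
proof -
  have "character_sum (correlation h F) \<pi> = character_sum (\<lambda>a. reflected_correlation h F (inv a)) \<pi>"
    unfolding character_sum_def correlation_def reflected_correlation_def by simp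
  also have "\<dots> = character_sum (reflected_correlation h F) (conj_character \<pi>)"
    using \<pi> by (rule character_sum_compose_inv)
  finally show ?thesis
    using character_sum_reflected_correlation[OF conj_character_in_characters[OF \<pi>]] by simp
qed

definition is_dicyclic_eigenpair ::
  "('a \<Rightarrow> complex) \<Rightarrow> ('a \<Rightarrow> complex) \<Rightarrow> complex \<Rightarrow> ('a \<Rightarrow> complex) \<Rightarrow> ('a \<Rightarrow> complex) \<Rightarrow> bool" where
  "is_dicyclic_eigenpair L M \<mu> F0 F1 \<longleftrightarrow>
    (\<exists>a\<in>carrier G. F0 a \<noteq> 0 \<or> F1 a \<noteq> 0) \<and>
    (\<forall>a\<in>carrier G. correlation L F0 a + reflected_correlation M F1 a = \<mu> * F0 a) \<and>
    (\<forall>a\<in>carrier G. reflected_correlation M F0 a + correlation L F1 a = \<mu> * F1 a)"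

lemma is_eigenvalue_dicyclic_kernel_iff_eigenpair:
  "is_eigenvalue (carrier G \<times> UNIV) (dicyclic_kernel L M) \<mu> \<longleftrightarrow>
    (\<exists>F0 F1. is_dicyclic_eigenpair L M \<mu> F0 F1)"
proof -
  let ?V = "carrier G \<times> (UNIV :: bool set)"
  have rows:
    "(\<Sum>v\<in>?V. dicyclic_kernel L M (a, False) v * f v) =
      correlation L (\<lambda>b. f (b, False)) a + reflected_correlation M (\<lambda>b. f (b, True)) a"
    "(\<Sum>v\<in>?V. dicyclic_kernel L M (a, True) v * f v) =
      reflected_correlation M (\<lambda>b. f (b, False)) a + correlation L (\<lambda>b. f (b, True)) a" for a f
    by (simp_all add: sum_Times_bool[OF finite_carrier] dicyclic_kernel_def correlation_def
        reflected_correlation_def)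
  show ?thesis
  proof
    assume "is_eigenvalue ?V (dicyclic_kernel L M) \<mu>"
    then obtain f a q where "a \<in> carrier G" "f (a, q) \<noteq> 0"
      and f: "\<forall>u\<in>?V. (\<Sum>v\<in>?V. dicyclic_kernel L M u v * f v) = \<mu> * f u"
      unfolding is_eigenvalue_def by blast
    then have "\<exists>a\<in>carrier G. f (a, False) \<noteq> 0 \<or> f (a, True) \<noteq> 0" by (cases q) auto
    then have "is_dicyclic_eigenpair L M \<mu> (\<lambda>a. f (a, False)) (\<lambda>a. f (a, True))"
      unfolding is_dicyclic_eigenpair_def rows[of _ f, symmetric] using f by blast
    then show "\<exists>F0 F1. is_dicyclic_eigenpair L M \<mu> F0 F1" by (intro exI)
  next
    assume "\<exists>F0 F1. is_dicyclic_eigenpair L M \<mu> F0 F1"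
    then obtain F0 F1 where F: "is_dicyclic_eigenpair L M \<mu> F0 F1" by blast
    define f where "f = (\<lambda>(a, q). if q then F1 a else F0 a)"
    have "\<exists>v\<in>?V. f v \<noteq> 0"
      using F by (force simp: is_dicyclic_eigenpair_def f_def)
    moreover have "(\<Sum>v\<in>?V. dicyclic_kernel L M (a, q) v * f v) = \<mu> * f (a, q)"
      if "a \<in> carrier G" for a q
      using F that by (cases q) (simp_all add: rows f_def is_dicyclic_eigenpair_def)
    ultimately show "is_eigenvalue ?V (dicyclic_kernel L M) \<mu>"
      unfolding is_eigenvalue_def by (intro exI[of _ f]) auto
  qed
qed

lemma character_sum_linear_relation:
  assumes "\<And>a. a \<in> carrier G \<Longrightarrow> f a + g a = c * h a"
  shows "character_sum f \<pi> + character_sum g \<pi> = c * character_sum h \<pi>"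
proof -
  have "f a * \<pi> a + g a * \<pi> a = c * (h a * \<pi> a)" if "a \<in> carrier G" for a
    using assms[OF that] by (simp flip: distrib_right mult.assoc)
  then show ?thesis
    by (simp add: character_sum_def sum_distrib_left flip: sum.distrib)
qed

lemma dicyclic_eigenpair_imp_character_equation:
  assumes "is_dicyclic_eigenpair L M \<mu> F0 F1"
  shows "\<exists>\<pi>\<in>characters. (\<mu> - character_sum L \<pi>) * (\<mu> - character_sum L (conj_character \<pi>)) =
    character_sum M (conj_character \<pi>) * character_sum M \<pi>"
proof -
  have nonzero: "\<exists>a\<in>carrier G. F0 a \<noteq> 0 \<or> F1 a \<noteq> 0"
    and row0: "\<And>a. a \<in> carrier G \<Longrightarrow> correlation L F0 a + reflected_correlation M F1 a = \<mu> * F0 a"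
    and row1: "\<And>a. a \<in> carrier G \<Longrightarrow> reflected_correlation M F0 a + correlation L F1 a = \<mu> * F1 a"
    using assms unfolding is_dicyclic_eigenpair_def by blast+
  have "\<exists>\<pi>\<in>characters. character_sum F0 (conj_character \<pi>) \<noteq> 0 \<or> character_sum F1 \<pi> \<noteq> 0"
  proof (rule ccontr)
    assume "\<not> ?thesis"
    then have zero: "\<forall>\<pi>\<in>characters. character_sum F0 (conj_character \<pi>) = 0"
      "\<forall>\<pi>\<in>characters. character_sum F1 \<pi> = 0" by blast+
    have "character_sum F0 \<pi> = 0" if "\<pi> \<in> characters" for \<pi>
      using bspec[OF zero(1) conj_character_in_characters[OF that]] by simp
    then have "\<forall>a\<in>carrier G. F0 a = 0 \<and> F1 a = 0"
      using zero(2) by (blast intro: character_completeness)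
    with nonzero show False by blast
  qed
  then obtain \<pi> where \<pi>: "\<pi> \<in> characters"
    and nonvanishing: "character_sum F0 (conj_character \<pi>) \<noteq> 0 \<or> character_sum F1 \<pi> \<noteq> 0" by blast
  let ?x = "character_sum F0 (conj_character \<pi>)" and ?y = "character_sum F1 \<pi>"
  have "?x * character_sum L \<pi> + ?y * character_sum M (conj_character \<pi>) = \<mu> * ?x"
    using character_sum_linear_relation[of "correlation L F0" "reflected_correlation M F1" \<mu> F0
        "conj_character \<pi>", OF row0] \<pi>
    by (simp add: character_sum_correlation character_sum_reflected_correlation
        conj_character_in_characters)
  moreover have "?x * character_sum M \<pi> + ?y * character_sum L (conj_character \<pi>) = \<mu> * ?y"
    using character_sum_linear_relation[of "reflected_correlation M F0" "correlation L F1" \<mu> F1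
        \<pi>, OF row1] \<pi>
    by (simp add: character_sum_correlation character_sum_reflected_correlation)
  ultimately have "(\<mu> - character_sum L \<pi>) * ?x = character_sum M (conj_character \<pi>) * ?y"
    "character_sum M \<pi> * ?x = (\<mu> - character_sum L (conj_character \<pi>)) * ?y"
    by (simp_all add: algebra_simps)
  then show ?thesis
    using \<pi> nonvanishing homogeneous_system_2_solvable_iff by blast
qed

lemma character_equation_imp_dicyclic_eigenpair:
  assumes \<pi>: "\<pi> \<in> characters"
    and eq: "(\<mu> - character_sum L \<pi>) * (\<mu> - character_sum L (conj_character \<pi>)) =
      character_sum M (conj_character \<pi>) * character_sum M \<pi>"
  shows "\<exists>F0 F1. is_dicyclic_eigenpair L M \<mu> F0 F1"
proof -
  obtain c d where cd: "c \<noteq> 0 \<or> d \<noteq> 0"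
    "(\<mu> - character_sum L \<pi>) * c = character_sum M (conj_character \<pi>) * d"
    "character_sum M \<pi> * c = (\<mu> - character_sum L (conj_character \<pi>)) * d"
    using iffD2[OF homogeneous_system_2_solvable_iff eq] by blast
  define F0 F1 where "F0 = (\<lambda>a. c * \<pi> a)" and "F1 = (\<lambda>a. d * cnj (\<pi> a))"
  note operators = correlation_character reflected_correlation_character
    \<pi> conj_character_in_characters[OF \<pi>]
  have "correlation L F0 a + reflected_correlation M F1 a = \<mu> * F0 a" if "a \<in> carrier G" for a
  proof -
    have "correlation L F0 a + reflected_correlation M F1 a =
        \<pi> a * (character_sum L \<pi> * c + character_sum M (conj_character \<pi>) * d)"
      using that by (simp add: F0_def F1_def operators algebra_simps)
    then show ?thesis unfolding cd(2)[symmetric] by (simp add: F0_def algebra_simps)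
  qed
  moreover have "reflected_correlation M F0 a + correlation L F1 a = \<mu> * F1 a"
    if "a \<in> carrier G" for a
  proof -
    have "reflected_correlation M F0 a + correlation L F1 a =
        cnj (\<pi> a) * (character_sum M \<pi> * c + character_sum L (conj_character \<pi>) * d)"
      using that by (simp add: F0_def F1_def operators algebra_simps)
    then show ?thesis unfolding cd(3) by (simp add: F1_def algebra_simps)
  qed
  moreover have "\<exists>a\<in>carrier G. F0 a \<noteq> 0 \<or> F1 a \<noteq> 0"
    using cd(1) \<pi> by (intro bexI[of _ \<one>]) (auto simp: F0_def F1_def character_one)
  ultimately have "is_dicyclic_eigenpair L M \<mu> F0 F1"
    unfolding is_dicyclic_eigenpair_def by blast
  then show ?thesis by (intro exI)
qed

theorem is_eigenvalue_dicyclic_kernel_iff: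
  "is_eigenvalue (carrier G \<times> UNIV) (dicyclic_kernel L M) \<mu> \<longleftrightarrow>
    (\<exists>\<pi>\<in>characters. (\<mu> - character_sum L \<pi>) * (\<mu> - character_sum L (conj_character \<pi>)) =
      character_sum M (conj_character \<pi>) * character_sum M \<pi>)"
  (is "?eigenvalue \<longleftrightarrow> ?equation")
proof
  assume ?eigenvalue
  then obtain F0 F1 where "is_dicyclic_eigenpair L M \<mu> F0 F1"
    unfolding is_eigenvalue_dicyclic_kernel_iff_eigenpair by blast
  then show ?equation by (rule dicyclic_eigenpair_imp_character_equation)
next
  assume ?equation
  then have "\<exists>F0 F1. is_dicyclic_eigenpair L M \<mu> F0 F1"
    by (elim bexE) (rule character_equation_imp_dicyclic_eigenpair)
  then show ?eigenvalue by (simp only: is_eigenvalue_dicyclic_kernel_iff_eigenpair)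
qed

corollary is_eigenvalue_real_dicyclic_kernel_iff:
  assumes L: "\<And>a. a \<in> carrier G \<Longrightarrow> L (inv a) = L a" and M: "M \<in> carrier G \<rightarrow> \<real>"
  shows "is_eigenvalue (carrier G \<times> UNIV) (dicyclic_kernel L M) \<mu> \<longleftrightarrow>
    (\<exists>\<pi>\<in>characters. \<mu> = character_sum L \<pi> + of_real (cmod (character_sum M \<pi>)) \<or>
      \<mu> = character_sum L \<pi> - of_real (cmod (character_sum M \<pi>)))"
  unfolding is_eigenvalue_dicyclic_kernel_iff
proof (rule bex_cong[OF refl])
  fix \<pi> assume \<pi>: "\<pi> \<in> characters"
  let ?L = "character_sum L \<pi>" and ?M = "character_sum M \<pi>"
  have L_cnj: "character_sum L (conj_character \<pi>) = ?L"
    using character_sum_compose_inv[OF \<pi>, of L] by (simp add: character_sum_def L)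
  have "cnj (M a) = M a" if "a \<in> carrier G" for a
    using M that by (simp add: Pi_iff Reals_cnj_iff)
  then have M_cnj: "character_sum M (conj_character \<pi>) = cnj ?M"
    by (simp add: character_sum_def)
  have "cnj ?M * ?M = (of_real (cmod ?M))\<^sup>2"
    using complex_norm_square[of ?M] by (simp add: mult.commute)
  then have "(\<mu> - ?L) * (\<mu> - ?L) = cnj ?M * ?M \<longleftrightarrow>
      \<mu> - ?L = of_real (cmod ?M) \<or> \<mu> - ?L = - of_real (cmod ?M)"
    by (simp only: power2_eq_iff flip: power2_eq_square)
  then show "(\<mu> - ?L) * (\<mu> - character_sum L (conj_character \<pi>)) =
        character_sum M (conj_character \<pi>) * ?M \<longleftrightarrow>
      \<mu> = ?L + of_real (cmod ?M) \<or> \<mu> = ?L - of_real (cmod ?M)"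
    unfolding L_cnj M_cnj by (auto simp: algebra_simps)
qed

lemma integral_character_sum_if_trivial_on_squares:
  assumes F: "F \<in> carrier G \<rightarrow> \<int>" and \<pi>: "\<pi> \<in> characters"
    and squares: "group_squares G \<subseteq> kernel G complex_units \<pi>"
  shows "character_sum F \<pi> \<in> \<int>"
  unfolding character_sum_def
proof (rule Ints_sum)
  fix a assume a: "a \<in> carrier G"
  then have "a \<otimes> a \<in> kernel G complex_units \<pi>" using squares by (auto simp: group_squares_def)
  then have "\<pi> a * \<pi> a = 1"
    using a \<pi> by (simp add: kernel_def complex_units_def flip: character_mult)
  then have "\<pi> a = 1 \<or> \<pi> a = -1" by (simp add: square_eq_1_iff)
  then show "F a * \<pi> a \<in> \<int>" using F a by auto
qed

lemma mset_eval_eq_character_sum: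
  "mset_eval \<pi> (mk_mset (carrier G) L) = character_sum (\<lambda>a. of_nat (L a)) \<pi>"
  by (simp add: mset_eval_def mk_mset_def character_sum_def)

end


section \<open>Word length and graph distance\<close>

lemma (in wf_digraph) awalk_length_Suc_iff:
  "(\<exists>p. awalk u p v \<and> length p = Suc n) \<longleftrightarrow>
    (\<exists>e\<in>arcs G. tail G e = u \<and> (\<exists>p. awalk (head G e) p v \<and> length p = n))"
proof
  assume "\<exists>p. awalk u p v \<and> length p = Suc n"
  then obtain e p where "awalk u (e # p) v" "length p = n" by (auto simp: length_Suc_conv)
  then show "\<exists>e\<in>arcs G. tail G e = u \<and> (\<exists>p. awalk (head G e) p v \<and> length p = n)"
    unfolding awalk_Cons_iff by blast
next
  assume "\<exists>e\<in>arcs G. tail G e = u \<and> (\<exists>p. awalk (head G e) p v \<and> length p = n)"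
  then obtain e p where "awalk u (e # p) v" "length (e # p) = Suc n"
    unfolding awalk_Cons_iff by auto
  then show "\<exists>p. awalk u p v \<and> length p = Suc n" by blast
qed

context group
begin

definition words_of_length :: "'a set \<Rightarrow> nat \<Rightarrow> 'a set" where
  "words_of_length S n = {foldr (\<otimes>) xs \<one> |xs. length xs = n \<and> set xs \<subseteq> S}"

lemma word_length_eq_Least: "word_length G S g = (LEAST n. g \<in> words_of_length S n)"
proof (cases "g = \<one>")
  case True
  then have "g \<in> words_of_length S 0" by (simp add: words_of_length_def)
  then show ?thesis using True by (simp add: word_length_def Least_eq_0)
next
  case False
  then have "1 \<le> n \<and> (\<exists>xs. length xs = n \<and> set xs \<subseteq> S \<and> g = foldr (\<otimes>) xs \<one>) \<longleftrightarrow>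
      g \<in> words_of_length S n" for n
    unfolding words_of_length_def by (cases n) auto
  then show ?thesis using False by (simp add: word_length_def)
qed

lemma words_of_length_0: "words_of_length S 0 = {\<one>}"
  by (auto simp: words_of_length_def)

lemma words_of_length_Suc: "words_of_length S (Suc n) = S <#> words_of_length S n"
proof (intro equalityI subsetI)
  fix g assume "g \<in> words_of_length S (Suc n)"
  then obtain x xs where "x \<in> S" "length xs = n" "set xs \<subseteq> S" "g = x \<otimes> foldr (\<otimes>) xs \<one>"
    by (auto simp: words_of_length_def length_Suc_conv)
  then show "g \<in> S <#> words_of_length S n"
    unfolding set_mult_def words_of_length_def by blast
next
  fix g assume "g \<in> S <#> words_of_length S n"
  then obtain x xs where "x \<in> S" "length xs = n" "set xs \<subseteq> S" "g = x \<otimes> foldr (\<otimes>) xs \<one>"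
    unfolding set_mult_def words_of_length_def by blast
  then have "length (x # xs) = Suc n" "set (x # xs) \<subseteq> S" "g = foldr (\<otimes>) (x # xs) \<one>"
    by simp_all
  then show "g \<in> words_of_length S (Suc n)"
    unfolding words_of_length_def by blast
qed

lemma words_of_length_subset:
  "S \<subseteq> carrier G \<Longrightarrow> words_of_length S n \<subseteq> carrier G"
  by (induction n) (simp_all add: words_of_length_0 words_of_length_Suc set_mult_closed)

lemma words_of_length_1: "S \<subseteq> carrier G \<Longrightarrow> words_of_length S 1 = S"
  by (force simp: words_of_length_0 words_of_length_Suc set_mult_def)

lemma words_of_length_add:
  assumes S: "S \<subseteq> carrier G"
  shows "words_of_length S (m + n) = words_of_length S m <#> words_of_length S n"
proof (induction m)
  case 0
  show ?case using words_of_length_subset[OF S, of n]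
    by (simp add: words_of_length_0 lcos_mult_one flip: l_coset_eq_set_mult)
next
  case (Suc m)
  then show ?case
    using S words_of_length_subset[OF S] by (simp add: words_of_length_Suc set_mult_assoc)
qed

lemma inv_mem_words_of_length:
  assumes S: "S \<subseteq> carrier G" "set_inv S = S" and "g \<in> words_of_length S n"
  shows "inv g \<in> words_of_length S n"
  using assms(3)
proof (induction n arbitrary: g)
  case 0
  then show ?case by (simp add: words_of_length_0)
next
  case (Suc n)
  then obtain x h where x: "x \<in> S" and h: "h \<in> words_of_length S n" and g: "g = x \<otimes> h"
    by (auto simp: words_of_length_Suc set_mult_def)
  have "inv x \<in> S" using x S(2) by (auto simp: SET_INV_def)
  moreover have "inv g = inv h \<otimes> inv x"
    unfolding g using x h S(1) words_of_length_subset[OF S(1)] by (intro inv_mult_group) auto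
  ultimately have "inv g \<in> words_of_length S n <#> words_of_length S 1"
    using Suc.IH[OF h] words_of_length_1[OF S(1)] by (auto simp: set_mult_def)
  then show ?case using words_of_length_add[OF S(1), of n 1] by simp
qed

lemma word_length_inv:
  assumes S: "S \<subseteq> carrier G" "set_inv S = S" and g: "g \<in> carrier G"
  shows "word_length G S (inv g) = word_length G S g"
proof -
  have "inv g \<in> words_of_length S n \<longleftrightarrow> g \<in> words_of_length S n" for n
    using inv_mem_words_of_length[OF S] g by (metis inv_inv)
  then show ?thesis by (simp add: word_length_eq_Least)
qed

lemma generate_imp_mem_words_of_length:
  assumes S: "S \<subseteq> carrier G" "set_inv S = S" and "g \<in> generate G S"
  shows "\<exists>n. g \<in> words_of_length S n"
  using assms(3)
proof induction
  case one
  show ?case using words_of_length_0 by blast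
next
  case (incl h)
  then show ?case using words_of_length_1[OF S(1)] by blast
next
  case (inv h)
  then have "inv h \<in> S" using S(2) by (auto simp: SET_INV_def)
  then show ?case using words_of_length_1[OF S(1)] by blast
next
  case (eng h k)
  then obtain m n where "h \<in> words_of_length S m" "k \<in> words_of_length S n" by blast
  then have "h \<otimes> k \<in> words_of_length S (m + n)"
    unfolding words_of_length_add[OF S(1)] by (auto simp: set_mult_def)
  then show ?case by blast
qed

lemma mem_words_of_length_Suc_iff:
  assumes S: "S \<subseteq> carrier G" and u: "u \<in> carrier G" and v: "v \<in> carrier G"
  shows "inv u \<otimes> v \<in> words_of_length S (Suc n) \<longleftrightarrow>
    (\<exists>w\<in>carrier G. inv u \<otimes> w \<in> S \<and> inv w \<otimes> v \<in> words_of_length S n)"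
proof
  assume "inv u \<otimes> v \<in> words_of_length S (Suc n)"
  then obtain x h where x: "x \<in> S" and h: "h \<in> words_of_length S n" and eq: "inv u \<otimes> v = x \<otimes> h"
    by (auto simp: words_of_length_Suc set_mult_def)
  have carrier: "x \<in> carrier G" "h \<in> carrier G"
    using x h S words_of_length_subset[OF S] by auto
  have "inv (u \<otimes> x) \<otimes> v = inv x \<otimes> (inv u \<otimes> v)"
    using u v carrier by (simp add: inv_mult_group m_assoc)
  also have "\<dots> = h" unfolding eq using carrier by (simp flip: m_assoc)
  finally have "inv (u \<otimes> x) \<otimes> v \<in> words_of_length S n" using h by simp
  moreover have "inv u \<otimes> (u \<otimes> x) \<in> S" using u carrier x by (simp flip: m_assoc)
  ultimately show "\<exists>w\<in>carrier G. inv u \<otimes> w \<in> S \<and> inv w \<otimes> v \<in> words_of_length S n"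
    using u carrier by blast
next
  assume "\<exists>w\<in>carrier G. inv u \<otimes> w \<in> S \<and> inv w \<otimes> v \<in> words_of_length S n"
  then obtain w where w: "w \<in> carrier G" "inv u \<otimes> w \<in> S" "inv w \<otimes> v \<in> words_of_length S n" by blast
  have "w \<otimes> (inv w \<otimes> v) = v" using v w(1) by (simp flip: m_assoc)
  then have "inv u \<otimes> v = (inv u \<otimes> w) \<otimes> (inv w \<otimes> v)"
    using u v w(1) by (simp add: m_assoc)
  then show "inv u \<otimes> v \<in> words_of_length S (Suc n)"
    using w(2,3) by (auto simp: words_of_length_Suc set_mult_def)
qed

lemma cayley_graph_simps:
  "pverts (cayley_graph G S) = carrier G"
  "parcs (cayley_graph G S) = {(g, h). g \<in> carrier G \<and> h \<in> carrier G \<and> inv g \<otimes> h \<in> S}"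
  by (simp_all add: cayley_graph_def)

lemma pair_wf_digraph_cayley_graph: "pair_wf_digraph (cayley_graph G S)"
  by unfold_locales (auto simp: cayley_graph_simps)

lemma cayley_graph_awalk_iff:
  assumes S: "S \<subseteq> carrier G" and u: "u \<in> carrier G" and v: "v \<in> carrier G"
  shows "(\<exists>p. pre_digraph.awalk (with_proj (cayley_graph G S)) u p v \<and> length p = n) \<longleftrightarrow>
    inv u \<otimes> v \<in> words_of_length S n"
  using u
proof (induction n arbitrary: u)
  interpret C: pair_wf_digraph "cayley_graph G S" by (rule pair_wf_digraph_cayley_graph)
  {
    case 0
    have "inv u \<otimes> v = \<one> \<longleftrightarrow> u = v"
      using 0 v by (metis inv_closed inv_equality inv_inv l_inv)
    then show ?case
      using 0 by (auto simp: C.awalk_Nil_iff cayley_graph_simps words_of_length_0)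
  next
    case (Suc n)
    have "(\<exists>p. C.awalk u p v \<and> length p = Suc n) \<longleftrightarrow>
        (\<exists>e\<in>parcs (cayley_graph G S). fst e = u \<and> (\<exists>p. C.awalk (snd e) p v \<and> length p = n))"
      by (simp add: C.awalk_length_Suc_iff)
    also have "\<dots> \<longleftrightarrow> (\<exists>w\<in>carrier G. inv u \<otimes> w \<in> S \<and> (\<exists>p. C.awalk w p v \<and> length p = n))"
      using Suc.prems by (auto simp: cayley_graph_simps)
    also have "\<dots> \<longleftrightarrow> (\<exists>w\<in>carrier G. inv u \<otimes> w \<in> S \<and> inv w \<otimes> v \<in> words_of_length S n)"
      using Suc.IH by blast
    also have "\<dots> \<longleftrightarrow> inv u \<otimes> v \<in> words_of_length S (Suc n)"
      by (rule mem_words_of_length_Suc_iff[OF S Suc.prems v, symmetric])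
    finally show ?case .
  }
qed

lemma graph_dist_cayley_graph:
  assumes "S \<subseteq> carrier G" "u \<in> carrier G" "v \<in> carrier G"
  shows "graph_dist (with_proj (cayley_graph G S)) u v = word_length G S (inv u \<otimes> v)"
  unfolding graph_dist_def cayley_graph_awalk_iff[OF assms] word_length_eq_Least ..

lemma connected_cayley_graph:
  assumes S: "S \<subseteq> carrier G" "set_inv S = S" "generate G S = carrier G"
  shows "Digraph_Component.connected (with_proj (cayley_graph G S))"
proof -
  interpret C: pair_wf_digraph "cayley_graph G S" by (rule pair_wf_digraph_cayley_graph)
  have "u \<rightarrow>\<^sup>*\<^bsub>with_proj (mk_symmetric (with_proj (cayley_graph G S)))\<^esub> v"
    if u: "u \<in> carrier G" and v: "v \<in> carrier G" for u v
  proof -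
    have "inv u \<otimes> v \<in> generate G S" using u v S(3) by simp
    then obtain n where "inv u \<otimes> v \<in> words_of_length S n"
      using generate_imp_mem_words_of_length[OF S(1,2)] by blast
    then obtain p where "C.awalk u p v"
      using cayley_graph_awalk_iff[OF S(1) u v, of n] by blast
    then show ?thesis using C.reachable_awalk C.reachable_mk_symmetricI by blast
  qed
  moreover have "carrier G \<noteq> {}" by auto
  ultimately show ?thesis
    unfolding Digraph_Component.connected_def strongly_connected_def
    by (simp add: cayley_graph_simps)
qed

end


section \<open>Distance integrality of Cayley graphs of dicyclic groups\<close>

lemma Ints_add_diff_of_real_iff:
  fixes z :: complex
  assumes "algebraic_int z"
  shows "z + of_real r \<in> \<int> \<and> z - of_real r \<in> \<int> \<longleftrightarrow> z \<in> \<int> \<and> r \<in> \<int>"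
proof -
  have "complex_of_real r \<in> \<int> \<longleftrightarrow> r \<in> \<int>"
    by (auto elim!: Ints_cases simp: complex_eq_iff)
  moreover have "z \<in> \<int> \<and> complex_of_real r \<in> \<int>"
    if plus: "z + of_real r \<in> \<int>" and minus: "z - of_real r \<in> \<int>"
  proof
    have "2 * z \<in> \<int>" using Ints_add[OF plus minus] by simp
    then have "2 * z / 2 \<in> \<rat>" using Ints_subset_Rats by (intro Rats_divide) auto
    then show "z \<in> \<int>" using assms by (simp add: rational_algebraic_int_is_int)
    then show "complex_of_real r \<in> \<int>" using Ints_diff[OF plus] by simp
  qed
  ultimately show ?thesis
    using Ints_add[of z "of_real r"] Ints_diff[of z "of_real r"] by blast
qed

locale dicyclic_cayley = finite_comm_group +
  fixes y :: 'a and S :: "('a \<times> bool) set"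
  assumes y: "y \<in> carrier G" "y \<otimes> y = \<one>"
    and S: "S \<subseteq> carrier (Dic G y)" "set_inv\<^bsub>Dic G y\<^esub> S = S"
      "generate (Dic G y) S = carrier (Dic G y)"
begin

sublocale D: group "Dic G y"
  using y by (rule group_Dic)

abbreviation base_length :: "'a \<Rightarrow> nat" where
  "base_length a \<equiv> word_length (Dic G y) S (dic_emb a)"

abbreviation coset_length :: "'a \<Rightarrow> nat" where
  "coset_length a \<equiv> word_length (Dic G y) S (dic_x G \<otimes>\<^bsub>Dic G y\<^esub> dic_emb a)"

lemma inv_Dic:
  assumes a: "a \<in> carrier G"
  shows "inv\<^bsub>Dic G y\<^esub> (a, False) = (inv a, False)"
    and "inv\<^bsub>Dic G y\<^esub> (a, True) = (y \<otimes> a, True)"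
proof -
  show "inv\<^bsub>Dic G y\<^esub> (a, False) = (inv a, False)"
    using a by (intro D.inv_equality) (simp_all add: Dic_def)
  show "inv\<^bsub>Dic G y\<^esub> (a, True) = (y \<otimes> a, True)"
    using a y by (intro D.inv_equality) (simp_all add: Dic_def inv_mult m_assoc)
qed

lemma base_length_inv: "a \<in> carrier G \<Longrightarrow> base_length (inv a) = base_length a"
  using D.word_length_inv[OF S(1,2), of "(a, False)"]
  by (simp add: Dic_def dic_emb_def flip: inv_Dic)

lemma coset_length_mult_y:
  assumes "a \<in> carrier G"
  shows "coset_length (y \<otimes> a) = coset_length a"
  using D.word_length_inv[OF S(1,2), of "(a, True)"] y assms
  by (simp add: Dic_normal_form inv_Dic) (simp add: Dic_def)

lemma distance_matrix_eq_dicyclic_kernel: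
  assumes "u \<in> carrier G \<times> UNIV" "v \<in> carrier G \<times> UNIV"
  shows "distance_matrix (with_proj (cayley_graph (Dic G y) S)) u v =
    dicyclic_kernel (\<lambda>a. of_nat (base_length a)) (\<lambda>a. of_nat (coset_length a)) u v"
proof -
  obtain a p where u: "u = (a, p)" "a \<in> carrier G" using assms(1) by auto
  obtain b q where v: "v = (b, q)" "b \<in> carrier G" using assms(2) by auto
  have "inv y = y" using y by (simp add: inv_equality)
  then have "y \<otimes> (inv (y \<otimes> a) \<otimes> b) = inv a \<otimes> b"
    using u v y by (simp add: inv_mult flip: m_assoc)
  moreover have "coset_length (y \<otimes> a \<otimes> b) = coset_length (a \<otimes> b)"
    using coset_length_mult_y[of "a \<otimes> b"] u v y by (simp add: m_assoc)
  moreover have "distance_matrix (with_proj (cayley_graph (Dic G y) S)) u v =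
      of_nat (word_length (Dic G y) S (inv\<^bsub>Dic G y\<^esub> u \<otimes>\<^bsub>Dic G y\<^esub> v))"
    unfolding distance_matrix_def using D.graph_dist_cayley_graph[OF S(1), of u v] u v
    by (simp add: Dic_def)
  ultimately show ?thesis
    using u v y
    by (cases p; cases q)
      (simp_all add: inv_Dic dicyclic_kernel_def Dic_normal_form, simp_all add: Dic_def dic_emb_def)
qed

theorem distance_integral_iff:
  "distance_integral (with_proj (cayley_graph (Dic G y) S)) \<longleftrightarrow>
    (\<forall>\<pi>\<in>characters. character_sum (\<lambda>a. of_nat (base_length a)) \<pi> \<in> \<int> \<and>
      cmod (character_sum (\<lambda>a. of_nat (coset_length a)) \<pi>) \<in> \<int>)"
proof -
  let ?\<Gamma> = "with_proj (cayley_graph (Dic G y) S)"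
  let ?L = "character_sum (\<lambda>a. of_nat (base_length a))"
    and ?M = "character_sum (\<lambda>a. of_nat (coset_length a))"
  have "verts ?\<Gamma> = carrier G \<times> UNIV" by (simp add: D.cayley_graph_simps) (simp add: Dic_def)
  then have "is_eigenvalue (verts ?\<Gamma>) (distance_matrix ?\<Gamma>) \<mu> \<longleftrightarrow>
      is_eigenvalue (carrier G \<times> UNIV)
        (dicyclic_kernel (\<lambda>a. of_nat (base_length a)) (\<lambda>a. of_nat (coset_length a))) \<mu>" for \<mu>
    using distance_matrix_eq_dicyclic_kernel by (simp only:) (rule is_eigenvalue_cong)
  then have eigenvalues: "is_eigenvalue (verts ?\<Gamma>) (distance_matrix ?\<Gamma>) \<mu> \<longleftrightarrow>
      (\<exists>\<pi>\<in>characters. \<mu> = ?L \<pi> + of_real (cmod (?M \<pi>)) \<or> \<mu> = ?L \<pi> - of_real (cmod (?M \<pi>)))" for \<mu>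
    by (simp add: is_eigenvalue_real_dicyclic_kernel_iff base_length_inv)
  have "distance_integral ?\<Gamma> \<longleftrightarrow>
      (\<forall>\<pi>\<in>characters. ?L \<pi> + of_real (cmod (?M \<pi>)) \<in> \<int> \<and> ?L \<pi> - of_real (cmod (?M \<pi>)) \<in> \<int>)"
    unfolding distance_integral_def eigenvalues using D.connected_cayley_graph[OF S] by blast
  also have "\<dots> \<longleftrightarrow> (\<forall>\<pi>\<in>characters. ?L \<pi> \<in> \<int> \<and> cmod (?M \<pi>) \<in> \<int>)"
    by (intro ball_cong refl Ints_add_diff_of_real_iff algebraic_int_character_sum) auto
  finally show ?thesis .
qed

end

theorem theorem5p1:
  fixes A :: "('a, 'b) monoid_scheme" and y :: 'a and S :: "('a \<times> bool) set"
  assumes "comm_group A" and "finite (carrier A)"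
    and "even (order A)" and "3 \<le> group_exponent A"
    and "y \<in> carrier A" and "group.ord A y = 2"
    and "S \<subseteq> carrier (Dic A y)" and "\<one>\<^bsub>Dic A y\<^esub> \<notin> S"
    and "set_inv\<^bsub>Dic A y\<^esub> S = S" and "generate (Dic A y) S = carrier (Dic A y)"
  shows "distance_integral (with_proj (cayley_graph (Dic A y) S)) \<longleftrightarrow>
    mk_mset (carrier A) (\<lambda>a. word_length (Dic A y) S (dic_emb a)) \<in> atomic_msets A \<and>
    (\<forall>\<pi>\<in>hom A complex_units. \<not> group_squares A \<subseteq> kernel A complex_units \<pi> \<longrightarrow>
       cmod (mset_eval \<pi> (mk_mset (carrier A)
         (\<lambda>a. word_length (Dic A y) S (dic_x A \<otimes>\<^bsub>Dic A y\<^esub> dic_emb a)))) \<in> \<int>)"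
proof -
  interpret comm_group A by fact
  have "y \<otimes>\<^bsub>A\<^esub> y = \<one>\<^bsub>A\<^esub>"
    using pow_ord_eq_1[OF assms(5)] assms(5,6) by (simp add: numeral_2_eq_2)
  then interpret dicyclic_cayley A y S
    using assms by unfold_locales
  let ?M = "character_sum (\<lambda>a. of_nat (coset_length a))"
  have "cmod (?M \<pi>) \<in> \<int>"
    if \<pi>: "\<pi> \<in> characters" and squares: "group_squares A \<subseteq> kernel A complex_units \<pi>" for \<pi>
  proof -
    have "?M \<pi> \<in> \<int>"
      using \<pi> squares by (intro integral_character_sum_if_trivial_on_squares) auto
    then show ?thesis by (auto elim!: Ints_cases)
  qed
  then have "(\<forall>\<pi>\<in>characters. cmod (?M \<pi>) \<in> \<int>) \<longleftrightarrow>
      (\<forall>\<pi>\<in>characters. \<not> group_squares A \<subseteq> kernel A complex_units \<pi> \<longrightarrow> cmod (?M \<pi>) \<in> \<int>)"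
    by blast
  then show ?thesis
    unfolding distance_integral_iff mset_eval_eq_character_sum
      atomic_mset_iff_integral_character_sums by blast
qed

end
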